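(* Let $T\in\mathcal{BC}(X)$, let $m\in\mathbb N_0$, and let $U\subset\mathbb H$ be a bounded slice Cauchy domain with $\sigma_S(T)\subset U$. For every $J\in\mathbb S$ we have $$P_m^2(T)=\frac1{2\pi}\int_{\partial(U\cap\mathbb C_J)}\mathcal P^L_2(s,T)\,ds_J\,s^{m+1},$$ where $$P_m^2(T):=2\Big((m+1)T^m+\sum_{k=0}^mT^{m-k}\overline T^{\,k}\Big).$$
   Context: $\mathbb H$: quaternions with units $e_1,e_2,e_3$. $\mathbb S$: imaginary units ($J^2=-1$). $\mathbb C_J=\mathbb R+J\mathbb R$, $ds_J=ds(-J)$. A set $U\subseteq\mathbb H$ is axially symmetric if $u+Iv\in U$ implies $u+Jv\in U$ for all $J\in\mathbb S$. A slice Cauchy domain is an axially symmetric open $U$ such that for every $J\in\mathbb S$ the boundary of $U\cap\mathbb C_J$ is a finite union of nonintersecting piecewise $C^1$ Jordan curves. $X=X_{\mathbb R}\otimes\mathbb H$ is a two-sided quaternionic Banach module, $X_{\mathbb R}$ a real Banach space; $\mathcal B(X)$ is the space of bounded right linear operators; $(aT)(x)=aT(x)$, $(Ta)(x)=T(ax)$ for $a\in\mathbb H$. $\mathcal{BC}(X)$: operators $T=T_0+T_1e_1+T_2e_2+T_3e_3$ with pairwise commuting $T_i\in\mathcal B(X_{\mathbb R})$; $\overline T=T_0-T_1e_1-T_2e_2-T_3e_3$. $\rho_S(T)=\{s\in\mathbb H:(T^2-2\mathrm{Re}(s)T+|s|^2\mathcal I)^{-1}\in\mathcal B(X)\}$,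 $\sigma_S(T)=\mathbb H\setminus\rho_S(T)$; for $T\in\mathcal{BC}(X)$, $\rho_S(T)$ is also the set of $s$ with $\mathcal Q_{c,s}(T):=s^2-s(T+\overline T)+T\overline T$ invertible in $\mathcal B(X)$. For $s\in\rho_S(T)$: $F_L(s,T)=-4(s\mathcal I-\overline T)\mathcal Q_{c,s}(T)^{-2}$ and $\mathcal P^L_2(s,T)=-F_L(s,T)s+T_0F_L(s,T)$. *)

theory Defs
  imports "HOL-Complex_Analysis.Complex_Analysis"
begin

section \<open>Quaternions\<close>

codatatype quat = Quat (qre: real) (qim1: real) (qim2: real) (qim3: real)

lemma quat_eq_iff:
  "x = y \<longleftrightarrow> qre x = qre y \<and> qim1 x = qim1 y \<and> qim2 x = qim2 y \<and> qim3 x = qim3 y"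
  by (auto intro: quat.expand)

instantiation quat :: ab_group_add
begin

primcorec zero_quat where
    "qre 0 = 0"
  | "qim1 0 = 0"
  | "qim2 0 = 0"
  | "qim3 0 = 0"

primcorec plus_quat where
    "qre (x + y) = qre x + qre y"
  | "qim1 (x + y) = qim1 x + qim1 y"
  | "qim2 (x + y) = qim2 x + qim2 y"
  | "qim3 (x + y) = qim3 x + qim3 y"

primcorec uminus_quat where
    "qre (- x) = - qre x"
  | "qim1 (- x) = - qim1 x"
  | "qim2 (- x) = - qim2 x"
  | "qim3 (- x) = - qim3 x"

primcorec minus_quat where
    "qre (x - y) = qre x - qre y"
  | "qim1 (x - y) = qim1 x - qim1 y"
  | "qim2 (x - y) = qim2 x - qim2 y"
  | "qim3 (x - y) = qim3 x - qim3 y"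

instance
  by standard (simp_all add: quat_eq_iff)

end

instantiation quat :: ring_1
begin

primcorec one_quat where
    "qre 1 = 1"
  | "qim1 1 = 0"
  | "qim2 1 = 0"
  | "qim3 1 = 0"

primcorec times_quat where
    "qre (x * y) = qre x * qre y - qim1 x * qim1 y - qim2 x * qim2 y - qim3 x * qim3 y"
  | "qim1 (x * y) = qre x * qim1 y + qim1 x * qre y + qim2 x * qim3 y - qim3 x * qim2 y"
  | "qim2 (x * y) = qre x * qim2 y - qim1 x * qim3 y + qim2 x * qre y + qim3 x * qim1 y"
  | "qim3 (x * y) = qre x * qim3 y + qim1 x * qim2 y - qim2 x * qim1 y + qim3 x * qre y"

instance
  by standard (simp_all add: quat_eq_iff algebra_simps)

end

instantiation quat :: real_algebra_1
begin

primcorec scaleR_quat where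
    "qre (scaleR r x) = r * qre x"
  | "qim1 (scaleR r x) = r * qim1 x"
  | "qim2 (scaleR r x) = r * qim2 x"
  | "qim3 (scaleR r x) = r * qim3 x"

instance
  by standard (simp_all add: quat_eq_iff algebra_simps)

end

instantiation quat :: real_inner
begin

definition inner_quat :: "quat \<Rightarrow> quat \<Rightarrow> real" where
  "inner_quat x y = qre x * qre y + qim1 x * qim1 y + qim2 x * qim2 y + qim3 x * qim3 y"

definition norm_quat :: "quat \<Rightarrow> real" where
  "norm_quat x = sqrt ((qre x)\<^sup>2 + (qim1 x)\<^sup>2 + (qim2 x)\<^sup>2 + (qim3 x)\<^sup>2)"

definition sgn_quat :: "quat \<Rightarrow> quat" where
  "sgn_quat x = x /\<^sub>R norm x"

definition dist_quat :: "quat \<Rightarrow> quat \<Rightarrow> real" where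
  "dist_quat x y = norm (x - y)"

definition uniformity_quat :: "(quat \<times> quat) filter" where
  "uniformity_quat = (INF e\<in>{0 <..}. principal {(x, y). dist x y < e})"

definition open_quat :: "quat set \<Rightarrow> bool" where
  "open_quat U \<longleftrightarrow> (\<forall>x\<in>U. eventually (\<lambda>(x', y). x' = x \<longrightarrow> y \<in> U) uniformity)"

instance
proof
  fix r :: real and x y z :: quat
  show "inner x y = inner y x"
    by (simp add: inner_quat_def mult.commute)
  show "inner (x + y) z = inner x z + inner y z"
    by (simp add: inner_quat_def algebra_simps)
  show "inner (scaleR r x) y = r * inner x y"
    by (simp add: inner_quat_def algebra_simps)
  show "0 \<le> inner x x"
    by (simp add: inner_quat_def)
  show "inner x x = 0 \<longleftrightarrow> x = 0"
    by (simp add: inner_quat_def quat_eq_iff add_nonneg_eq_0_iff)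
  show "norm x = sqrt (inner x x)"
    by (simp add: norm_quat_def inner_quat_def power2_eq_square)
qed (rule sgn_quat_def dist_quat_def open_quat_def uniformity_quat_def)+

end

instance quat :: real_normed_algebra_1
proof
  fix x y :: quat
  have "norm (x * y) = norm x * norm y"
    unfolding norm_quat_def real_sqrt_mult [symmetric]
    by (rule arg_cong [where f = sqrt]) (simp add: power2_eq_square algebra_simps)
  then show "norm (x * y) \<le> norm x * norm y"
    by simp
  show "norm (1 :: quat) = 1"
    by (simp add: norm_quat_def)
qed

definition e1 :: quat where "e1 = Quat 0 1 0 0"
definition e2 :: quat where "e2 = Quat 0 0 1 0"
definition e3 :: quat where "e3 = Quat 0 0 0 1"

definition imag_units :: "quat set" where
  "imag_units = {J. J ^ 2 = -1}"

text \<open>The identification \<open>u + i v \<mapsto> u + J v\<close> of the complex plane with \<open>\<complex>\<^sub>J\<close>.\<close>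

definition slice_emb :: "quat \<Rightarrow> complex \<Rightarrow> quat" where
  "slice_emb J z = of_real (Re z) + J * of_real (Im z)"


section \<open>Slice Cauchy domains\<close>

definition axially_symmetric :: "quat set \<Rightarrow> bool" where
  "axially_symmetric U \<longleftrightarrow>
     (\<forall>u v. \<forall>I\<in>imag_units. of_real u + I * of_real v \<in> U \<longrightarrow>
        (\<forall>J\<in>imag_units. of_real u + J * of_real v \<in> U))"

text \<open>\<open>U \<inter> \<complex>\<^sub>J\<close>, transported to the complex plane. Boundaries are taken relative
  to the plane \<open>\<complex>\<^sub>J\<close>.\<close>

definition slice_trace :: "quat set \<Rightarrow> quat \<Rightarrow> complex set" where
  "slice_trace U J = {z. slice_emb J z \<in> U}"

text \<open>\<^const>\<open>valid_path\<close> is the library's notion of a piecewise \<open>C\<^sup>1\<close> path.\<close>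

definition jordan_boundary :: "complex set \<Rightarrow> (real \<Rightarrow> complex) set \<Rightarrow> bool" where
  "jordan_boundary D \<Gamma> \<longleftrightarrow>
     finite \<Gamma> \<and>
     (\<forall>\<gamma>\<in>\<Gamma>. valid_path \<gamma> \<and> simple_path \<gamma> \<and> pathfinish \<gamma> = pathstart \<gamma>) \<and>
     pairwise (\<lambda>\<gamma> \<delta>. path_image \<gamma> \<inter> path_image \<delta> = {}) \<Gamma> \<and>
     frontier D = (\<Union>\<gamma>\<in>\<Gamma>. path_image \<gamma>)"

definition slice_cauchy_domain :: "quat set \<Rightarrow> bool" where
  "slice_cauchy_domain U \<longleftrightarrow>
     open U \<and> axially_symmetric U \<and>
     (\<forall>J\<in>imag_units. \<exists>\<Gamma>. jordan_boundary (slice_trace U J) \<Gamma>)"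

text \<open>An integral over \<open>\<partial>D\<close> uses the positive orientation of the boundary curves. As
  usual for systems of Jordan curves, this means that the cycle winds once around each
  point of \<open>D\<close> and not at all around the points outside the closure of \<open>D\<close>.\<close>

definition positive_boundary :: "complex set \<Rightarrow> (real \<Rightarrow> complex) set \<Rightarrow> bool" where
  "positive_boundary D \<Gamma> \<longleftrightarrow>
     jordan_boundary D \<Gamma> \<and>
     (\<forall>z\<in>D. (\<Sum>\<gamma>\<in>\<Gamma>. winding_number \<gamma> z) = 1) \<and>
     (\<forall>z. z \<notin> closure D \<longrightarrow> (\<Sum>\<gamma>\<in>\<Gamma>. winding_number \<gamma> z) = 0)"


section \<open>The two-sided quaternionic Banach module \<open>X = X\<^sub>\<real> \<otimes> \<bbbH>\<close>\<close>

text \<open>With \<open>'a\<close> in the role of \<open>X\<^sub>\<real>\<close>, the tuple \<open>(x0, x1, x2, x3)\<close> stands for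
  \<open>x0 + x1 e1 + x2 e2 + x3 e3\<close>. The product type carries the norm
  \<open>sqrt (\<parallel>x0\<parallel>\<^sup>2 + \<parallel>x1\<parallel>\<^sup>2 + \<parallel>x2\<parallel>\<^sup>2 + \<parallel>x3\<parallel>\<^sup>2)\<close>; any other norm inducing the product topology
  gives the same bounded operators and the same limits of operators.\<close>

type_synonym 'a qmod = "'a \<times> 'a \<times> 'a \<times> 'a"

fun lmult :: "quat \<Rightarrow> 'a::real_vector qmod \<Rightarrow> 'a qmod" where
  "lmult a (x0, x1, x2, x3) =
    (qre a *\<^sub>R x0 - qim1 a *\<^sub>R x1 - qim2 a *\<^sub>R x2 - qim3 a *\<^sub>R x3,
     qre a *\<^sub>R x1 + qim1 a *\<^sub>R x0 + qim2 a *\<^sub>R x3 - qim3 a *\<^sub>R x2,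
     qre a *\<^sub>R x2 - qim1 a *\<^sub>R x3 + qim2 a *\<^sub>R x0 + qim3 a *\<^sub>R x1,
     qre a *\<^sub>R x3 + qim1 a *\<^sub>R x2 - qim2 a *\<^sub>R x1 + qim3 a *\<^sub>R x0)"

fun rmult :: "'a::real_vector qmod \<Rightarrow> quat \<Rightarrow> 'a qmod" where
  "rmult (x0, x1, x2, x3) a =
    (qre a *\<^sub>R x0 - qim1 a *\<^sub>R x1 - qim2 a *\<^sub>R x2 - qim3 a *\<^sub>R x3,
     qim1 a *\<^sub>R x0 + qre a *\<^sub>R x1 + qim3 a *\<^sub>R x2 - qim2 a *\<^sub>R x3,
     qim2 a *\<^sub>R x0 - qim3 a *\<^sub>R x1 + qre a *\<^sub>R x2 + qim1 a *\<^sub>R x3,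
     qim3 a *\<^sub>R x0 + qim2 a *\<^sub>R x1 - qim1 a *\<^sub>R x2 + qre a *\<^sub>R x3)"

lemma lmult_mult: "lmult (a * b) x = lmult a (lmult b x)"
  by (cases x) (simp add: algebra_simps)

lemma rmult_mult: "rmult x (a * b) = rmult (rmult x a) b"
  by (cases x) (simp add: algebra_simps)

lemma lmult_rmult: "lmult a (rmult x b) = rmult (lmult a x) b"
  by (cases x) (simp add: algebra_simps)


section \<open>Operators\<close>

type_synonym 'a qop = "'a qmod \<Rightarrow>\<^sub>L 'a qmod"

definition BX :: "'a::real_normed_vector qop set" where
  "BX = {A. \<forall>x a. blinfun_apply A (rmult x a) = rmult (blinfun_apply A x) a}"

text \<open>The operator \<open>a \<I>\<close>, i.e. left multiplication by \<open>a\<close>.\<close>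

lift_definition lmul_op :: "quat \<Rightarrow> 'a::real_normed_vector qop" is lmult
proof -
  fix a
  have eq: "lmult a = (\<lambda>x :: 'a qmod. lmult a (fst x, fst (snd x), fst (snd (snd x)), snd (snd (snd x))))"
    by (simp add: fun_eq_iff)
  show "bounded_linear (lmult a :: 'a qmod \<Rightarrow> 'a qmod)"
    by (subst eq, unfold lmult.simps) (intro bounded_linear_Pair bounded_linear_add bounded_linear_sub
        bounded_linear_const_scaleR bounded_linear_fst bounded_linear_snd
        bounded_linear_fst_comp bounded_linear_snd_comp bounded_linear_ident)
qed

text \<open>The two \<open>\<bbbH>\<close>-module structures of \<open>\<B>(X)\<close>: \<open>(a A)(x) = a (A x)\<close> and
  \<open>(A a)(x) = A (a x)\<close>.\<close>

definition op_lscale :: "quat \<Rightarrow> 'a::real_normed_vector qop \<Rightarrow> 'a qop" (infixr "\<cdot>\<^sub>l" 75) where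
  "a \<cdot>\<^sub>l A = lmul_op a o\<^sub>L A"

definition op_rscale :: "'a::real_normed_vector qop \<Rightarrow> quat \<Rightarrow> 'a qop" (infixl "\<cdot>\<^sub>r" 75) where
  "A \<cdot>\<^sub>r a = A o\<^sub>L lmul_op a"

primrec op_pow :: "'a::real_normed_vector qop \<Rightarrow> nat \<Rightarrow> 'a qop" where
  "op_pow A 0 = id_blinfun"
| "op_pow A (Suc n) = A o\<^sub>L op_pow A n"

definition is_op_inverse :: "'a::real_normed_vector qop \<Rightarrow> 'a qop \<Rightarrow> bool" where
  "is_op_inverse A B \<longleftrightarrow> B \<in> BX \<and> A o\<^sub>L B = id_blinfun \<and> B o\<^sub>L A = id_blinfun"

definition op_invertible :: "'a::real_normed_vector qop \<Rightarrow> bool" where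
  "op_invertible A \<longleftrightarrow> (\<exists>B. is_op_inverse A B)"

definition op_inv :: "'a::real_normed_vector qop \<Rightarrow> 'a qop" where
  "op_inv A = (THE B. is_op_inverse A B)"

lemma op_inv_eqI:
  assumes "is_op_inverse A B"
  shows "op_inv A = B"
  unfolding op_inv_def
proof (rule the_equality)
  fix C assume C: "is_op_inverse A C"
  have "C o\<^sub>L (A o\<^sub>L B) = (C o\<^sub>L A) o\<^sub>L B"
    by (rule blinfun_eqI) simp
  then have "C o\<^sub>L id_blinfun = id_blinfun o\<^sub>L B"
    using assms C by (simp add: is_op_inverse_def)
  then have "blinfun_apply C x = blinfun_apply B x" for x
    by (metis blinfun_apply_blinfun_compose id_blinfun.rep_eq)
  then show "C = B"
    by (rule blinfun_eqI)
qed (fact assms)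

text \<open>The componentwise action of \<open>A \<in> \<B>(X\<^sub>\<real>)\<close> on \<open>X\<close>.\<close>

lift_definition real_op :: "('a::real_normed_vector \<Rightarrow>\<^sub>L 'a) \<Rightarrow> 'a qop"
  is "\<lambda>A x. (A (fst x), A (fst (snd x)), A (fst (snd (snd x))), A (snd (snd (snd x))))"
  by (intro bounded_linear_Pair bounded_linear_compose [OF _ bounded_linear_fst]
      bounded_linear_compose [OF _ bounded_linear_fst_comp]
      bounded_linear_compose [OF _ bounded_linear_snd_comp]
      bounded_linear_snd bounded_linear_snd_comp)

definition qop ::
  "('a::real_normed_vector \<Rightarrow>\<^sub>L 'a) \<Rightarrow> ('a \<Rightarrow>\<^sub>L 'a) \<Rightarrow> ('a \<Rightarrow>\<^sub>L 'a) \<Rightarrow> ('a \<Rightarrow>\<^sub>L 'a) \<Rightarrow> 'a qop" where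
  "qop A0 A1 A2 A3 = real_op A0 + real_op A1 \<cdot>\<^sub>r e1 + real_op A2 \<cdot>\<^sub>r e2 + real_op A3 \<cdot>\<^sub>r e3"

definition BC :: "'a::real_normed_vector qop set" where
  "BC = {qop A0 A1 A2 A3 | A0 A1 A2 A3.
          \<forall>A\<in>{A0, A1, A2, A3}. \<forall>B\<in>{A0, A1, A2, A3}. A o\<^sub>L B = B o\<^sub>L A}"

lemma qop_apply:
  "blinfun_apply (qop A0 A1 A2 A3) (x, 0, 0, 0) = (A0 x, A1 x, A2 x, A3 x)"
  by (simp add: qop_def op_rscale_def lmul_op.rep_eq real_op.rep_eq e1_def e2_def e3_def
      blinfun.add_left blinfun.minus_right)

lemma qop_eq_iff:
  "qop A0 A1 A2 A3 = qop B0 B1 B2 B3 \<longleftrightarrow> A0 = B0 \<and> A1 = B1 \<and> A2 = B2 \<and> A3 = B3"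
proof
  assume eq: "qop A0 A1 A2 A3 = qop B0 B1 B2 B3"
  have "(A0 x, A1 x, A2 x, A3 x) = (B0 x, B1 x, B2 x, B3 x)" for x
    using arg_cong [OF eq, of "\<lambda>A. blinfun_apply A (x, 0, 0, 0)"] by (simp add: qop_apply)
  then show "A0 = B0 \<and> A1 = B1 \<and> A2 = B2 \<and> A3 = B3"
    by (auto intro: blinfun_eqI)
qed simp

text \<open>By \<open>qop_eq_iff\<close> the components of an operator are unique, so the next two
  descriptions are well defined on \<^const>\<open>BC\<close>.\<close>

definition op_conj :: "'a::real_normed_vector qop \<Rightarrow> 'a qop" where
  "op_conj T = (THE S. \<exists>A0 A1 A2 A3. T = qop A0 A1 A2 A3 \<and>
     S = real_op A0 - real_op A1 \<cdot>\<^sub>r e1 - real_op A2 \<cdot>\<^sub>r e2 - real_op A3 \<cdot>\<^sub>r e3)"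

definition op_re :: "'a::real_normed_vector qop \<Rightarrow> 'a qop" where
  "op_re T = (THE S. \<exists>A0 A1 A2 A3. T = qop A0 A1 A2 A3 \<and> S = real_op A0)"

lemma op_conj_qop:
  "op_conj (qop A0 A1 A2 A3) =
     real_op A0 - real_op A1 \<cdot>\<^sub>r e1 - real_op A2 \<cdot>\<^sub>r e2 - real_op A3 \<cdot>\<^sub>r e3"
  unfolding op_conj_def by (rule the_equality) (auto simp: qop_eq_iff)

lemma op_re_qop: "op_re (qop A0 A1 A2 A3) = real_op A0"
  unfolding op_re_def by (rule the_equality) (auto simp: qop_eq_iff)


section \<open>The \<open>S\<close>-spectrum and the kernels\<close>

definition S_resolvent_set :: "'a::real_normed_vector qop \<Rightarrow> quat set" where
  "S_resolvent_set T =
     {s. op_invertible (op_pow T 2 - (2 * qre s) *\<^sub>R T + (norm s)\<^sup>2 *\<^sub>R id_blinfun)}"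

definition S_spectrum :: "'a::real_normed_vector qop \<Rightarrow> quat set" where
  "S_spectrum T = - S_resolvent_set T"

definition Q_c :: "quat \<Rightarrow> 'a::real_normed_vector qop \<Rightarrow> 'a qop" where
  "Q_c s T = lmul_op (s ^ 2) - s \<cdot>\<^sub>l (T + op_conj T) + (T o\<^sub>L op_conj T)"

definition F_L :: "quat \<Rightarrow> 'a::real_normed_vector qop \<Rightarrow> 'a qop" where
  "F_L s T = (-4) *\<^sub>R ((lmul_op s - op_conj T) o\<^sub>L op_pow (op_inv (Q_c s T)) 2)"

definition P2_L :: "quat \<Rightarrow> 'a::real_normed_vector qop \<Rightarrow> 'a qop" where
  "P2_L s T = - (F_L s T \<cdot>\<^sub>r s) + (op_re T o\<^sub>L F_L s T)"

definition P2 :: "nat \<Rightarrow> 'a::real_normed_vector qop \<Rightarrow> 'a qop" where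
  "P2 m T = 2 *\<^sub>R (real (m + 1) *\<^sub>R op_pow T m
                    + (\<Sum>k=0..m. op_pow T (m - k) o\<^sub>L op_pow (op_conj T) k))"

text \<open>The integral of \<open>f(s) ds\<^sub>J g(s)\<close> over the curves of \<open>\<Gamma>\<close>, carried to \<open>\<complex>\<^sub>J\<close> by
  \<^const>\<open>slice_emb\<close>, where \<open>ds\<^sub>J = ds (-J)\<close>.\<close>

definition slice_integral ::
  "quat \<Rightarrow> (real \<Rightarrow> complex) set \<Rightarrow> (quat \<Rightarrow> 'a::real_normed_vector qop) \<Rightarrow> (quat \<Rightarrow> quat) \<Rightarrow> 'a qop"
  where
  "slice_integral J \<Gamma> f g =
     (\<Sum>\<gamma>\<in>\<Gamma>. integral {0..1}
        (\<lambda>t. f (slice_emb J (\<gamma> t))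
               \<cdot>\<^sub>r (slice_emb J (vector_derivative \<gamma> (at t within {0..1})) * (- J))
               \<cdot>\<^sub>r g (slice_emb J (\<gamma> t))))"

end

theory Submission
  imports Defs
begin

text \<open>On the slice \<open>\<complex>\<^sub>J\<close> the operators \<open>T\<^sub>0\<close> and \<open>N = T T'\<close> (with \<open>T'\<close> the conjugate of \<open>T\<close>)
  commute with \<open>J\<close>, so \<open>Q\<^sub>c s T = s\<^sup>2 - 2 s T\<^sub>0 + N\<close> is a quadratic pencil with a holomorphic inverse
  \<open>R s\<close>. The integrand is \<open>4 (s - T') (s - T\<^sub>0) R\<^sup>2 s\<^sup>m\<^sup>+\<^sup>1 ds\<^sub>J\<close>, and since \<open>R' = - 2 (s - T\<^sub>0) R\<^sup>2\<close>,
  integration by parts reduces it to the moments \<open>M k = (1 / 2\<pi>) \<integral> s\<^sup>k R ds\<^sub>J\<close>. They satisfy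
  \<open>M (k + 2) = 2 T\<^sub>0 M (k + 1) - N M k\<close> because \<open>s\<^sup>k Q R = s\<^sup>k\<close> has integral zero.
  The initial values \<open>M 0 = 0\<close> and \<open>M 1 = 1\<close> need a global argument, as the curves may lie in different
  components of the resolvent set: by the resolvent equation, the Cauchy transform of \<open>R\<close> at \<open>w\<close> equals
  \<open>(1 - M 1 + (2 T\<^sub>0 - w) M 0) R w\<close> up to the factor \<open>2 \<pi> J\<close>, so this expression extends to an
  entire function vanishing at infinity. Operator-valued integrals are compared with scalar ones by means of
  the Hahn-Banach theorem.\<close>

text \<open>The obstacle on a slice is that \<open>T\<close> and \<open>T'\<close> need not commute
  with left multiplication by \<open>J\<close>; only \<open>T\<^sub>0\<close>, \<open>N\<close> and
  hence the inverse of \<open>Q\<^sub>c\<close> do. All holomorphic arguments are therefore run in a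
  pencil where \<open>T\<close> and \<open>T'\<close> do not occur, and \<open>T'\<close> is kept as
  the leftmost factor of its term, from where it leaves the integral as a real-linear map. Both come
  back at the end as commuting roots of \<open>x\<^sup>2 - 2 T\<^sub>0 x + N\<close>, the
  characteristic polynomial of the recurrence, so \<open>M (k + 1) - T' M k\<close> is a power of
  \<open>T\<close> and \<open>M (k + 1)\<close> the sum in \<open>P2\<close>. Integration by parts
  leaves \<open>2 (m + 2) M (m + 1) - 2 (m + 1) T' M m\<close>; splitting \<open>m + 2\<close> as
  \<open>(m + 1) + 1\<close> gives the two terms of \<open>P2\<close>. A separate algebraic point:
  the spectrum is defined by \<open>T\<^sup>2 - 2 Re s T + \<bar>s\<bar>\<^sup>2\<close>, while the
  kernels invert \<open>Q\<^sub>c\<close>. The pair \<open>T\<close>, \<open>T'\<close> enters the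
  former as \<open>s\<close> and its conjugate enter the latter, up to sign, so the two operators
  share one modulus.\<close>

section \<open>The Hahn-Banach theorem\<close>

definition sublinear :: "('a::real_vector \<Rightarrow> real) \<Rightarrow> bool" where
  "sublinear q \<longleftrightarrow> (\<forall>x y. q (x + y) \<le> q x + q y) \<and> (\<forall>t>0. \<forall>x. q (t *\<^sub>R x) = t * q x)"

lemma sublinearI:
  assumes "\<And>x y. q (x + y) \<le> q x + q y"
    and le: "\<And>t x. 0 < t \<Longrightarrow> q (t *\<^sub>R x) \<le> t * q x"
  shows "sublinear q"
  unfolding sublinear_def
proof (intro conjI allI impI antisym le)
  fix t :: real and x assume t: "0 < t"
  \<comment> \<open>The assumption at \<open>1/t\<close> and \<open>t *\<^sub>R x\<close> is the
    reverse inequality.\<close>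
  have "q ((1/t) *\<^sub>R t *\<^sub>R x) \<le> (1/t) * q (t *\<^sub>R x)"
    using t by (intro le) simp
  then show "t * q x \<le> q (t *\<^sub>R x)"
    using t by (simp add: field_simps)
qed (use assms in auto)

lemma sublinear_add: "sublinear q \<Longrightarrow> q (x + y) \<le> q x + q y"
  and sublinear_scaleR: "sublinear q \<Longrightarrow> 0 < t \<Longrightarrow> q (t *\<^sub>R x) = t * q x"
  by (auto simp: sublinear_def)

lemma sublinear_zero: "sublinear q \<Longrightarrow> q 0 = 0"
  using sublinear_scaleR [of q 2 0] by simp

lemma sublinear_minus: "sublinear q \<Longrightarrow> - q (- x) \<le> q x"
  using sublinear_add [of q x "- x"] by (simp add: sublinear_zero)

text \<open>Provides the bounds of chains for Zorn's lemma. Domination by \<open>p\<close> keeps the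
  infimum finite, since \<open>- p (- x) \<le> - q (- x) \<le> q x\<close>; for any \<open>q\<close>
  and \<open>r\<close> the chain has a member below both, which is what subadditivity of an infimum
  requires.\<close>

lemma sublinear_INF_chain:
  assumes "C \<noteq> {}" and sub: "\<And>q. q \<in> C \<Longrightarrow> sublinear q"
    and le: "\<And>q x. q \<in> C \<Longrightarrow> q x \<le> p x"
    and chain: "\<And>q r. q \<in> C \<Longrightarrow> r \<in> C \<Longrightarrow> (\<forall>x. q x \<le> r x) \<or> (\<forall>x. r x \<le> q x)"
  shows "sublinear (\<lambda>x. INF q\<in>C. q x)" and "q \<in> C \<Longrightarrow> (INF q\<in>C. q x) \<le> q x"
proof -
  have bdd: "bdd_below ((\<lambda>q. q x) ` C)" for x
  proof (rule bdd_belowI2)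
    fix q assume "q \<in> C"
    then show "- p (- x) \<le> q x"
      using sublinear_minus [OF sub, of q x] le [of q "- x"] by linarith
  qed
  have lower: "(INF q\<in>C. q x) \<le> q x" if "q \<in> C" for q x
    by (rule cINF_lower [OF bdd that])
  show "q \<in> C \<Longrightarrow> (INF q\<in>C. q x) \<le> q x"
    by (rule lower)
  show "sublinear (\<lambda>x. INF q\<in>C. q x)"
  proof (rule sublinearI)
    fix x y
    have *: "(INF q\<in>C. q (x + y)) \<le> q x + r y" if qr: "q \<in> C" "r \<in> C" for q r
    proof -
      obtain s where "s \<in> C" "s x \<le> q x" "s y \<le> r y"
        using chain [OF qr] qr by blast
      then show ?thesis
        using lower [of s "x + y"] sublinear_add [OF sub, of s x y] by linarith
    qed
    have "(INF q\<in>C. q (x + y)) - r y \<le> (INF q\<in>C. q x)" if "r \<in> C" for r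
      using * [OF _ that] by (intro cINF_greatest \<open>C \<noteq> {}\<close>) (simp add: algebra_simps)
    then have "(INF q\<in>C. q (x + y)) - (INF q\<in>C. q x) \<le> (INF q\<in>C. q y)"
      by (intro cINF_greatest \<open>C \<noteq> {}\<close>) (simp add: algebra_simps)
    then show "(INF q\<in>C. q (x + y)) \<le> (INF q\<in>C. q x) + (INF q\<in>C. q y)"
      by simp
  next
    fix t :: real and x :: 'a assume t: "0 < t"
    have "(INF q\<in>C. q (t *\<^sub>R x)) / t \<le> (INF q\<in>C. q x)"
    proof (rule cINF_greatest [OF \<open>C \<noteq> {}\<close>])
      fix q assume q: "q \<in> C"
      show "(INF q\<in>C. q (t *\<^sub>R x)) / t \<le> q x"
        using lower [OF q, of "t *\<^sub>R x"] sublinear_scaleR [OF sub [OF q] t] t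
        by (simp add: field_simps)
    qed
    then show "(INF q\<in>C. q (t *\<^sub>R x)) \<le> t * (INF q\<in>C. q x)"
      using t by (simp add: field_simps)
  qed
qed

text \<open>\<open>r\<close> is the largest sublinear functional below \<open>q\<close> whose value
  at \<open>- y\<close> is at most \<open>- q y\<close>. The choices \<open>t = 0\<close> and
  \<open>t = 1\<close> give the two bounds; when \<open>q\<close> is minimal, \<open>r = q\<close>
  and the last bound becomes superadditivity.\<close>

lemma sublinear_shrink:
  fixes q :: "'a::real_vector \<Rightarrow> real" and y :: 'a
  assumes q: "sublinear q"
  defines "r \<equiv> \<lambda>x. INF t\<in>{0..}. q (x + t *\<^sub>R y) - t * q y"
  shows "sublinear r" and "r x \<le> q x" and "r x \<le> q (x + y) - q y"
proof -
  have qt: "q (t *\<^sub>R y) = t * q y" if "t \<ge> 0" for t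
    using that sublinear_scaleR [OF q] sublinear_zero [OF q] by (cases "t = 0") auto
  have bdd: "bdd_below ((\<lambda>t. q (x + t *\<^sub>R y) - t * q y) ` {0..})" for x
  proof (rule bdd_belowI2)
    fix t :: real assume "t \<in> {0..}"
    then show "- q (- x) \<le> q (x + t *\<^sub>R y) - t * q y"
      using sublinear_add [OF q, of "- x" "x + t *\<^sub>R y"] qt by simp
  qed
  have lower: "r x \<le> q (x + t *\<^sub>R y) - t * q y" if "0 \<le> t" for x t
    unfolding r_def using that by (intro cINF_lower [OF bdd]) simp
  show "r x \<le> q x" "r x \<le> q (x + y) - q y"
    using lower [of 0 x] lower [of 1 x] by simp_all
  have greatest: "c \<le> r x" if "\<And>t. 0 \<le> t \<Longrightarrow> c \<le> q (x + t *\<^sub>R y) - t * q y" for c x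
    unfolding r_def using that by (intro cINF_greatest) auto
  show "sublinear r"
  proof (rule sublinearI)
    fix x z
    have *: "r (x + z) \<le> (q (x + s *\<^sub>R y) - s * q y) + (q (z + t *\<^sub>R y) - t * q y)"
      if "0 \<le> s" "0 \<le> t" for s t
      using lower [of "s + t" "x + z"] that sublinear_add [OF q, of "x + s *\<^sub>R y" "z + t *\<^sub>R y"]
      by (simp add: algebra_simps)
    have "r (x + z) - (q (x + s *\<^sub>R y) - s * q y) \<le> r z" if "0 \<le> s" for s
      by (intro greatest) (use * [OF that] in \<open>simp add: algebra_simps\<close>)
    then have "r (x + z) - r z \<le> r x"
      by (intro greatest) (simp add: algebra_simps)
    then show "r (x + z) \<le> r x + r z"
      by simp
  next
    fix t :: real and x assume t: "0 < t"
    have "r (t *\<^sub>R x) / t \<le> r x"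
    proof (rule greatest)
      fix s :: real assume "0 \<le> s"
      then have "r (t *\<^sub>R x) \<le> q (t *\<^sub>R (x + s *\<^sub>R y)) - t * s * q y"
        using lower [of "t * s" "t *\<^sub>R x"] t by (simp add: algebra_simps)
      also have "\<dots> = t * (q (x + s *\<^sub>R y) - s * q y)"
        by (simp only: sublinear_scaleR [OF q t]) (simp add: algebra_simps)
      finally show "r (t *\<^sub>R x) / t \<le> q (x + s *\<^sub>R y) - s * q y"
        using t by (simp add: field_simps)
    qed
    then show "r (t *\<^sub>R x) \<le> t * r x"
      using t by (simp add: field_simps)
  qed
qed

lemma minimal_sublinear_exists:
  assumes p: "sublinear p"
  obtains q where "sublinear q" "\<And>x. q x \<le> p x"
    "\<And>r. sublinear r \<Longrightarrow> (\<And>x. r x \<le> q x) \<Longrightarrow> r = q"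
proof -
  define A where "A = {q. sublinear q \<and> (\<forall>x. q x \<le> p x)}"
  have "\<exists>m\<in>A. \<forall>a\<in>A. (\<forall>x. a x \<le> m x) \<longrightarrow> a = m"
  proof (rule predicate_Zorn)
    \<comment> \<open>The order is reversed: a maximal element is a pointwise minimal functional,
      and upper bounds of chains are infima.\<close>
    show "partial_order_on A (relation_of (\<lambda>m a. \<forall>x. a x \<le> m x) A)"
    proof (rule partial_order_on_relation_ofI)
      show "a = b" if "\<forall>x. b x \<le> a x" "\<forall>x. a x \<le> b x" for a b :: "'a \<Rightarrow> real"
        using that by (intro ext antisym) auto
      show "\<forall>x. c x \<le> a x" if "\<forall>x. b x \<le> a x" "\<forall>x. c x \<le> b x" for a b c :: "'a \<Rightarrow> real"
        using that by (meson order_trans)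
    qed simp
  next
    fix C assume C: "C \<in> Chains (relation_of (\<lambda>m a. \<forall>x. a x \<le> m x) A)"
    then have CA: "C \<subseteq> A"
      and chain: "\<And>q r. q \<in> C \<Longrightarrow> r \<in> C \<Longrightarrow> (\<forall>x. q x \<le> r x) \<or> (\<forall>x. r x \<le> q x)"
      by (auto simp: Chains_def relation_of_def)
    show "\<exists>u\<in>A. \<forall>a\<in>C. \<forall>x. u x \<le> a x"
    proof (cases "C = {}")
      case True
      then show ?thesis
        using p by (auto simp: A_def)
    next
      case False
      have sub: "sublinear q" and le: "q x \<le> p x" if "q \<in> C" for q x
        using that CA by (auto simp: A_def)
      have *: "sublinear (\<lambda>x. INF q\<in>C. q x)"
        by (rule sublinear_INF_chain (1) [where p = p]) (fact False sub le chain)+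
      have lower: "(INF q\<in>C. q x) \<le> q x" if "q \<in> C" for q x
        by (rule sublinear_INF_chain (2) [where p = p]) (fact False sub le chain that)+
      have "(INF q\<in>C. q x) \<le> p x" for x
      proof -
        obtain q where "q \<in> C" using False by blast
        with lower [OF this, of x] le [OF this, of x] show ?thesis by linarith
      qed
      then have "(\<lambda>x. INF q\<in>C. q x) \<in> A"
        using * by (simp add: A_def)
      then show ?thesis
        using lower by (intro bexI [where x = "\<lambda>x. INF q\<in>C. q x"]) auto
    qed
  qed
  then obtain m where m: "m \<in> A" "\<And>a. a \<in> A \<Longrightarrow> (\<forall>x. a x \<le> m x) \<Longrightarrow> a = m"
    by blast
  show ?thesis
  proof (rule that)
    show "sublinear m" "\<And>x. m x \<le> p x"
      using m(1) by (simp_all add: A_def)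
    show "r = m" if "sublinear r" "\<And>x. r x \<le> m x" for r
    proof (rule m(2))
      have "r x \<le> p x" for x
        using that(2) [of x] m(1) by (simp add: A_def) (meson order_trans)
      with that(1) show "r \<in> A"
        by (simp add: A_def)
    qed (use that(2) in simp)
  qed
qed

text \<open>A minimal sublinear functional is linear, since shrinking it in any direction has no effect.
  Shrinking the norm in the direction \<open>x\<^sub>0\<close> beforehand forces the value at \<open>x\<^sub>0\<close>.\<close>

theorem Hahn_Banach_norming:
  fixes x0 :: "'a::real_normed_vector"
  obtains \<phi> where "bounded_linear \<phi>" "\<phi> x0 = norm x0" "\<And>x. \<bar>\<phi> x\<bar> \<le> norm x"
proof -
  have norm: "sublinear (norm :: 'a \<Rightarrow> real)"
    by (rule sublinearI) (auto simp: norm_triangle_ineq)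
  define p where "p x = (INF t\<in>{0..}. norm (x + t *\<^sub>R x0) - t * norm x0)" for x
  have p: "sublinear p" "p x \<le> norm x" "p x \<le> norm (x + x0) - norm x0" for x
    unfolding p_def by (rule sublinear_shrink [OF norm])+
  obtain q where q: "sublinear q" "\<And>x. q x \<le> p x"
    and min: "\<And>r. sublinear r \<Longrightarrow> (\<And>x. r x \<le> q x) \<Longrightarrow> r = q"
    using minimal_sublinear_exists [OF p(1)] by blast
  have add: "q (x + y) = q x + q y" for x y
  proof -
    have "(\<lambda>x. INF t\<in>{0..}. q (x + t *\<^sub>R y) - t * q y) = q"
      by (intro min sublinear_shrink q(1))
    then have "q x \<le> q (x + y) - q y"
      using sublinear_shrink (3) [OF q(1), where y = y and x = x] by (simp add: fun_eq_iff)
    with sublinear_add [OF q(1), of x y] show ?thesis by linarith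
  qed
  have minus: "q (- x) = - q x" for x
    using add [of x "- x"] sublinear_zero [OF q(1)] by simp
  have scale: "q (t *\<^sub>R x) = t * q x" for t x
  proof (cases t "0 :: real" rule: linorder_cases)
    case less
    then have "q ((- t) *\<^sub>R x) = (- t) * q x"
      by (intro sublinear_scaleR [OF q(1)]) simp
    then show ?thesis
      by (simp add: minus)
  qed (auto simp: sublinear_zero [OF q(1)] sublinear_scaleR [OF q(1)])
  have le: "q x \<le> norm x" for x
    using q(2) [of x] p(2) [of x] by linarith
  have abs: "\<bar>q x\<bar> \<le> norm x" for x
    using le [of x] le [of "- x"] by (simp add: minus)
  have "bounded_linear q"
    by (rule bounded_linear_intro [where K = 1]) (use abs in \<open>auto simp: add scale\<close>)
  \<comment> \<open>At \<open>- x0\<close> the last bound on \<open>p\<close> reads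
    \<open>p (- x0) \<le> norm 0 - norm x0\<close>.\<close>
  moreover have "q x0 = norm x0"
    using q(2) [of "- x0"] p(3) [of "- x0"] le [of x0] by (simp add: minus)
  ultimately show ?thesis
    using that abs by blast
qed

section \<open>Integrals of vector-valued holomorphic functions\<close>

text \<open>\<open>K\<close> is multiplication by the imaginary unit, and complex scalars enter
  through \<open>act\<close>. The operator spaces below carry only real scalars as types, and their
  complex structure depends on the chosen slice.\<close>

locale complex_structure =
  fixes K :: "'b::banach \<Rightarrow> 'b"
  assumes bounded_linear_K: "bounded_linear K"
    and K_K: "K (K v) = - v"
begin

interpretation K: bounded_linear K
  by (rule bounded_linear_K)

definition act :: "complex \<Rightarrow> 'b \<Rightarrow> 'b" where
  "act z v = Re z *\<^sub>R v + Im z *\<^sub>R K v"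

text \<open>The usual complexification \<open>\<phi> v - \<i> \<phi> (K v)\<close> of a real
  functional, complex linear for \<open>act\<close> by \<open>cfun_act\<close>.\<close>

definition cfun :: "('b \<Rightarrow> real) \<Rightarrow> 'b \<Rightarrow> complex" where
  "cfun \<phi> v = Complex (\<phi> v) (- \<phi> (K v))"

definition cderiv :: "(complex \<Rightarrow> 'b) \<Rightarrow> 'b \<Rightarrow> complex \<Rightarrow> bool" where
  "cderiv F D z \<longleftrightarrow> (F has_derivative (\<lambda>h. act h D)) (at z)"

definition vint :: "(real \<Rightarrow> complex) \<Rightarrow> (complex \<Rightarrow> 'b) \<Rightarrow> 'b" where
  "vint \<gamma> F = integral {0..1} (\<lambda>t. act (vector_derivative \<gamma> (at t within {0..1})) (F (\<gamma> t)))"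

lemma act_mult: "act (z * w) v = act z (act w v)"
  by (simp add: act_def K.add K.scaleR K_K algebra_simps)

lemma act_scaleR: "act (r *\<^sub>R z) v = r *\<^sub>R act z v"
  by (simp add: act_def algebra_simps)

lemma bounded_bilinear_act: "bounded_bilinear act"
proof -
  obtain B where B: "\<And>v. norm (K v) \<le> norm v * B"
    using K.nonneg_bounded by blast
  show ?thesis
  proof
    show "\<exists>M. \<forall>z v. norm (act z v) \<le> norm z * norm v * M"
    proof (intro exI allI)
      fix z v
      have "norm (act z v) \<le> \<bar>Re z\<bar> * norm v + \<bar>Im z\<bar> * norm (K v)"
        unfolding act_def by (rule order_trans [OF norm_triangle_ineq]) simp
      also have "\<dots> \<le> norm z * norm v + norm z * (norm v * B)"
        by (intro add_mono mult_mono abs_Re_le_cmod abs_Im_le_cmod B) auto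
      finally show "norm (act z v) \<le> norm z * norm v * (1 + B)"
        by (simp add: algebra_simps)
    qed
  qed (simp_all add: act_def K.add K.scaleR algebra_simps)
qed

sublocale act: bounded_bilinear act
  by (rule bounded_bilinear_act)

lemma bounded_linear_cfun:
  assumes "bounded_linear \<phi>"
  shows "bounded_linear (cfun \<phi>)"
proof -
  have "cfun \<phi> = (\<lambda>v. of_real (\<phi> v) - \<i> * of_real (\<phi> (K v)))"
    by (auto simp: cfun_def complex_eq_iff)
  moreover have "bounded_linear \<dots>"
    by (intro bounded_linear_sub bounded_linear_const_mult bounded_linear_compose [OF bounded_linear_of_real]
        assms bounded_linear_compose [OF assms] bounded_linear_K)
  ultimately show ?thesis by simp
qed

lemma cfun_act:
  assumes "bounded_linear \<phi>"
  shows "cfun \<phi> (act z v) = z * cfun \<phi> v"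
proof -
  interpret \<phi>: bounded_linear \<phi> by fact
  show ?thesis
    by (simp add: cfun_def act_def complex_eq_iff \<phi>.add \<phi>.scaleR \<phi>.neg \<phi>.diff K.add K.scaleR K_K)
qed

text \<open>A functional norming \<open>v - w\<close> separates the two vectors. Through this lemma,
  identities between vector-valued integrals reduce to scalar contour integrals.\<close>

lemma cfun_eqI:
  assumes "\<And>\<phi>. bounded_linear \<phi> \<Longrightarrow> cfun \<phi> v = cfun \<phi> w"
  shows "v = w"
proof -
  obtain \<phi> where \<phi>: "bounded_linear \<phi>" "\<phi> (v - w) = norm (v - w)"
    using Hahn_Banach_norming by blast
  moreover have "\<phi> v = \<phi> w"
    using assms [OF \<phi>(1)] by (simp add: cfun_def)
  ultimately show ?thesis
    using linear_diff [OF bounded_linear.linear [OF \<phi>(1)], of v w] by simp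
qed

lemma cderiv_cfun:
  assumes "bounded_linear \<phi>" "cderiv F D z"
  shows "((\<lambda>z. cfun \<phi> (F z)) has_field_derivative cfun \<phi> D) (at z)"
proof -
  have "((\<lambda>z. cfun \<phi> (F z)) has_derivative (\<lambda>h. cfun \<phi> (act h D))) (at z)"
    using bounded_linear.has_derivative [OF bounded_linear_cfun [OF assms(1)]] assms(2)
    unfolding cderiv_def by blast
  moreover have "(\<lambda>h. cfun \<phi> (act h D)) = (*) (cfun \<phi> D)"
    by (simp add: fun_eq_iff cfun_act [OF assms(1)])
  ultimately show ?thesis
    by (simp add: has_field_derivative_def)
qed

lemma cderiv_imp_continuous: "cderiv F D z \<Longrightarrow> isCont F z"
  unfolding cderiv_def by (rule has_derivative_continuous)

text \<open>The functional passes under the integral sign, and complex linearity of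
  \<open>cfun\<close> leaves a scalar contour integrand with primitive \<open>g\<close>.\<close>

lemma cfun_segment_integral:
  assumes \<phi>: "bounded_linear \<phi>" and cont: "continuous_on (closed_segment w z) F"
    and prim: "\<And>x. x \<in> closed_segment w z \<Longrightarrow> (g has_field_derivative cfun \<phi> (F x)) (at x within S)"
    and S: "closed_segment w z \<subseteq> S"
  shows "cfun \<phi> (integral {0..1} (\<lambda>u. act (z - w) (F (linepath w z u)))) = g z - g w"
proof -
  have int: "(\<lambda>u. act (z - w) (F (linepath w z u))) integrable_on {0..1}"
    by (intro integrable_continuous_interval act.continuous_on continuous_intros
        continuous_on_compose2 [OF cont]) (auto simp: linepath_in_path)
  have "((\<lambda>u. cfun \<phi> (act (z - w) (F (linepath w z u)))) has_integral
      cfun \<phi> (integral {0..1} (\<lambda>u. act (z - w) (F (linepath w z u))))) {0..1}"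
    using has_integral_linear [OF integrable_integral [OF int] bounded_linear_cfun [OF \<phi>]]
    by (simp add: o_def)
  then have "((\<lambda>x. cfun \<phi> (F x)) has_contour_integral
      cfun \<phi> (integral {0..1} (\<lambda>u. act (z - w) (F (linepath w z u))))) (linepath w z)"
    by (simp add: has_contour_integral_linepath cfun_act [OF \<phi>] mult.commute)
  moreover have "((\<lambda>x. cfun \<phi> (F x)) has_contour_integral (g z - g w)) (linepath w z)"
    using contour_integral_primitive [of "closed_segment w z" g "\<lambda>x. cfun \<phi> (F x)" "linepath w z"]
      DERIV_subset [OF prim S] by auto
  ultimately show ?thesis
    by (rule has_contour_integral_unique)
qed

text \<open>The primitive is obtained by integration along segments; its additivity is tested against
  functionals, so that Goursat's theorem is only needed for scalar functions.\<close>

lemma local_primitive: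
  assumes F: "\<And>z. z \<in> ball c r \<Longrightarrow> cderiv F (F' z) z"
  obtains G where "\<And>z. z \<in> ball c r \<Longrightarrow> cderiv G (F z) z"
proof (cases "r > 0")
  case False
  then have "ball c r = {}"
    by simp
  then show ?thesis
    using that by blast
next
  case True
  define L where "L w z = integral {0..1} (\<lambda>u. act (z - w) (F (linepath w z u)))" for w z
  have contF: "continuous_on (ball c r) F"
    using F cderiv_imp_continuous by (meson continuous_at_imp_continuous_on)
  have seg: "closed_segment w z \<subseteq> ball c r" if "w \<in> ball c r" "z \<in> ball c r" for w z
    using that by (intro closed_segment_subset) auto
  have add: "L c z - L c w = L w z" if z: "z \<in> ball c r" and w: "w \<in> ball c r" for z w
  proof (rule cfun_eqI)
    fix \<phi> :: "'b \<Rightarrow> real" assume \<phi>: "bounded_linear \<phi>"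
    have "(\<lambda>z. cfun \<phi> (F z)) holomorphic_on ball c r"
      using cderiv_cfun [OF \<phi> F] unfolding holomorphic_on_open [OF open_ball] by blast
    then obtain g where g: "\<And>x. x \<in> ball c r \<Longrightarrow>
        (g has_field_derivative cfun \<phi> (F x)) (at x within ball c r)"
      using holomorphic_convex_primitive' [of "ball c r" "\<lambda>z. cfun \<phi> (F z)"] by auto
    have *: "cfun \<phi> (L a b) = g b - g a" if "a \<in> ball c r" "b \<in> ball c r" for a b
      unfolding L_def using seg [OF that] g
      by (intro cfun_segment_integral [OF \<phi> continuous_on_subset [OF contF], where S = "ball c r"])
        auto
    have "cfun \<phi> (L c z - L c w) = cfun \<phi> (L c z) - cfun \<phi> (L c w)"
      by (rule linear_diff [OF bounded_linear.linear [OF bounded_linear_cfun [OF \<phi>]]])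
    then show "cfun \<phi> (L c z - L c w) = cfun \<phi> (L w z)"
      using * z w True by simp
  qed
  obtain M where M: "M > 0" "\<And>h v. norm (act h v) \<le> norm h * norm v * M"
    using act.pos_bounded by blast
  show ?thesis
  proof (rule that)
    fix w assume w: "w \<in> ball c r"
    show "cderiv (L c) (F w) w"
      unfolding cderiv_def has_derivative_at_alt
    proof (intro conjI allI impI)
      show "bounded_linear (\<lambda>h. act h (F w))"
        by (rule act.bounded_linear_left)
      fix e :: real assume e: "e > 0"
      have "isCont F w"
        using F [OF w] by (rule cderiv_imp_continuous)
      \<comment> \<open>\<open>M\<close> bounds the bilinear map \<open>act\<close>; the tolerance
        \<open>e / M\<close> absorbs it.\<close>
      then obtain d where d: "d > 0" "\<And>x. dist x w < d \<Longrightarrow> dist (F x) (F w) < e / M"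
        using e M(1) by (metis continuous_at_eps_delta divide_pos_pos)
      obtain d' where d': "d' > 0" "ball w d' \<subseteq> ball c r"
        using w openE [OF open_ball] by blast
      show "\<exists>d>0. \<forall>y. norm (y - w) < d \<longrightarrow>
          norm (L c y - L c w - act (y - w) (F w)) \<le> e * norm (y - w)"
      proof (intro exI [of _ "min d d'"] conjI allI impI)
        fix y assume y: "norm (y - w) < min d d'"
        then have yc: "y \<in> ball c r"
          using d'(2) by (auto simp: dist_norm norm_minus_commute)
        have int: "(\<lambda>u. act (y - w) (F (linepath w y u))) integrable_on {0..1}"
          using seg [OF w yc]
          by (intro integrable_continuous_interval act.continuous_on continuous_intros
              continuous_on_compose2 [OF contF]) (auto simp: linepath_in_path)
        have "L w y - act (y - w) (F w)
            = integral {0..1} (\<lambda>u. act (y - w) (F (linepath w y u)) - act (y - w) (F w))"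
          unfolding L_def by (subst integral_diff [OF int]) auto
        also have "norm \<dots> \<le> (e * norm (y - w)) * (1 - 0)"
        proof (rule integral_bound)
          show "continuous_on {0..1} (\<lambda>u. act (y - w) (F (linepath w y u)) - act (y - w) (F w))"
            using seg [OF w yc]
            by (intro act.continuous_on continuous_intros continuous_on_compose2 [OF contF])
              (auto simp: linepath_in_path)
          fix u :: real assume u: "u \<in> {0..1}"
          have "linepath w y u - w = u *\<^sub>R (y - w)"
            by (simp add: linepath_def algebra_simps)
          then have "dist (linepath w y u) w \<le> norm (y - w)"
            using u by (simp add: dist_norm mult_left_le_one_le)
          then have "dist (F (linepath w y u)) (F w) < e / M"
            using y by (intro d(2)) simp
          have "norm (act (y - w) (F (linepath w y u)) - act (y - w) (F w))
              = norm (act (y - w) (F (linepath w y u) - F w))"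
            by (simp add: act.diff_right)
          also have "\<dots> \<le> norm (y - w) * norm (F (linepath w y u) - F w) * M"
            by (rule M(2))
          also have "\<dots> \<le> norm (y - w) * (e / M) * M"
            using \<open>dist (F (linepath w y u)) (F w) < e / M\<close> M(1)
            by (intro mult_right_mono mult_left_mono) (auto simp: dist_norm)
          finally show "norm (act (y - w) (F (linepath w y u)) - act (y - w) (F w)) \<le> e * norm (y - w)"
            using M(1) by (simp add: mult.commute)
        qed simp
        finally show "norm (L c y - L c w - act (y - w) (F w)) \<le> e * norm (y - w)"
          using add [OF yc w] by simp
      qed (use d d' in auto)
    qed
  qed
qed

text \<open>The fundamental theorem of calculus, which tolerates the finitely many corners of the
  path. It is stated for subintervals because a primitive is in general available only locally along
  \<open>\<gamma>\<close>.\<close>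

lemma has_integral_cderiv:
  assumes \<gamma>: "valid_path \<gamma>" and ab: "0 \<le> a" "a \<le> b" "b \<le> 1"
    and G: "\<And>t. t \<in> {a..b} \<Longrightarrow> cderiv G (F (\<gamma> t)) (\<gamma> t)"
  shows "((\<lambda>t. act (vector_derivative \<gamma> (at t within {0..1})) (F (\<gamma> t)))
    has_integral (G (\<gamma> b) - G (\<gamma> a))) {a..b}"
proof -
  obtain S where S: "finite S" "\<gamma> C1_differentiable_on {0..1} - S"
    using \<gamma> by (auto simp: valid_path_def piecewise_C1_differentiable_on_def)
  show ?thesis
  proof (rule fundamental_theorem_of_calculus_interior_strong [OF S(1) ab(2)])
    fix t assume t: "t \<in> {a<..<b} - S"
    have "(\<gamma> has_vector_derivative vector_derivative \<gamma> (at t)) (at t)"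
      using S(2) t ab by (auto simp: C1_differentiable_on_eq vector_derivative_works)
    moreover have "at t within {0..1} = at t"
      using t ab by (intro at_within_Icc_at) auto
    ultimately have "(\<gamma> has_derivative (\<lambda>h. h *\<^sub>R vector_derivative \<gamma> (at t within {0..1}))) (at t)"
      by (simp add: has_vector_derivative_def)
    moreover have "(G has_derivative (\<lambda>h. act h (F (\<gamma> t)))) (at (\<gamma> t))"
      using G t by (simp add: cderiv_def)
    ultimately show "((\<lambda>t. G (\<gamma> t)) has_vector_derivative
        act (vector_derivative \<gamma> (at t within {0..1})) (F (\<gamma> t))) (at t)"
      unfolding has_vector_derivative_def act_scaleR [symmetric]
      by (rule has_derivative_compose)
  next
    have "continuous_on {a..b} \<gamma>"
      using valid_path_imp_path [OF \<gamma>] unfolding path_def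
      by (rule continuous_on_subset) (use ab in auto)
    moreover have "continuous_on (\<gamma> ` {a..b}) G"
      using cderiv_imp_continuous [OF G] by (auto intro!: continuous_at_imp_continuous_on)
    ultimately show "continuous_on {a..b} (\<lambda>t. G (\<gamma> t))"
      by (metis continuous_on_compose2 order_refl)
  qed
qed

definition vintegrable :: "(real \<Rightarrow> complex) \<Rightarrow> (complex \<Rightarrow> 'b) \<Rightarrow> bool" where
  "vintegrable \<gamma> F \<longleftrightarrow>
    (\<lambda>t. act (vector_derivative \<gamma> (at t within {0..1})) (F (\<gamma> t))) integrable_on {0..1}"

text \<open>The derivative of a valid path may be unbounded near finitely many points, so continuity of
  \<open>F\<close> is not enough here.\<close>

lemma vintegrable_cderiv:
  assumes \<gamma>: "valid_path \<gamma>" and S: "open S" "path_image \<gamma> \<subseteq> S"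
    and F: "\<And>z. z \<in> S \<Longrightarrow> cderiv F (F' z) z"
  shows "vintegrable \<gamma> F"
  unfolding vintegrable_def
proof -
  let ?f = "\<lambda>t. act (vector_derivative \<gamma> (at t within {0..1})) (F (\<gamma> t))"
  \<comment> \<open>Integrability need only be checked on short intervals around each
    \<open>t\<close>; there \<open>\<gamma>\<close> stays in a ball on which \<open>F\<close> has a
    primitive.\<close>
  have "?f integrable_on cbox 0 1"
  proof (rule integrable_on_little_subintervals, intro ballI)
    fix t :: real assume t: "t \<in> cbox 0 1"
    then have "\<gamma> t \<in> S"
      using S(2) by (auto simp: path_image_def)
    then obtain r where r: "r > 0" "ball (\<gamma> t) r \<subseteq> S"
      using S(1) openE by blast
    then obtain G where G: "\<And>z. z \<in> ball (\<gamma> t) r \<Longrightarrow> cderiv G (F z) z"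
      using local_primitive [of "\<gamma> t" r F F'] F by blast
    have "continuous_on {0..1} \<gamma>"
      using valid_path_imp_path [OF \<gamma>] by (simp add: path_def)
    then obtain d where d: "d > 0"
      "\<And>s. s \<in> {0..1} \<Longrightarrow> dist s t < d \<Longrightarrow> dist (\<gamma> s) (\<gamma> t) < r"
      using t r(1) unfolding continuous_on_iff by (metis box_real(2))
    have "?f integrable_on cbox u v"
      if uv: "t \<in> cbox u v" "cbox u v \<subseteq> ball t d" "cbox u v \<subseteq> cbox 0 1" for u v
    proof -
      have le: "0 \<le> u" "u \<le> v" "v \<le> 1"
        using uv(1,3) by auto
      have "cderiv G (F (\<gamma> s)) (\<gamma> s)" if s: "s \<in> {u..v}" for s
        using that uv d(2) [of s] by (intro G) (auto simp: dist_commute)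
      then show ?thesis
        using has_integral_cderiv [OF \<gamma> le] by (auto simp: integrable_on_def)
    qed
    then show "\<exists>d>0. \<forall>u v. t \<in> cbox u v \<and> cbox u v \<subseteq> ball t d \<and> cbox u v \<subseteq> cbox 0 1 \<longrightarrow>
        ?f integrable_on cbox u v"
      using d(1) by blast
  qed
  then show "?f integrable_on {0..1}"
    by simp
qed

lemma vint_cderiv_closed:
  assumes "valid_path \<gamma>" "pathfinish \<gamma> = pathstart \<gamma>"
    and "\<And>z. z \<in> path_image \<gamma> \<Longrightarrow> cderiv G (F z) z"
  shows "vintegrable \<gamma> F" and "vint \<gamma> F = 0"
proof -
  have "((\<lambda>t. act (vector_derivative \<gamma> (at t within {0..1})) (F (\<gamma> t)))
      has_integral (G (\<gamma> 1) - G (\<gamma> 0))) {0..1}"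
    using assms by (intro has_integral_cderiv) (auto simp: path_image_def)
  then show "vintegrable \<gamma> F" "vint \<gamma> F = 0"
    using assms(2) by (auto simp: vintegrable_def vint_def pathfinish_def pathstart_def
        integrable_on_def integral_unique)
qed

lemma vintegrable_diff: "vintegrable \<gamma> F \<Longrightarrow> vintegrable \<gamma> G \<Longrightarrow> vintegrable \<gamma> (\<lambda>z. F z - G z)"
  unfolding vintegrable_def act.diff_right by (rule integrable_diff)

lemma vint_diff:
  "vintegrable \<gamma> F \<Longrightarrow> vintegrable \<gamma> G \<Longrightarrow> vint \<gamma> (\<lambda>z. F z - G z) = vint \<gamma> F - vint \<gamma> G"
  unfolding vintegrable_def vint_def act.diff_right by (rule integral_diff)

lemma vint_cong: "(\<And>z. z \<in> path_image \<gamma> \<Longrightarrow> F z = G z) \<Longrightarrow> vint \<gamma> F = vint \<gamma> G"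
  unfolding vint_def by (intro integral_cong) (auto simp: path_image_def)

lemma vintegrable_cong:
  "(\<And>z. z \<in> path_image \<gamma> \<Longrightarrow> F z = G z) \<Longrightarrow> vintegrable \<gamma> F \<longleftrightarrow> vintegrable \<gamma> G"
  unfolding vintegrable_def by (intro integrable_cong) (auto simp: path_image_def)

text \<open>Commuting with \<open>K\<close> makes \<open>L\<close> complex linear, so it passes
  through \<open>act\<close>.\<close>

lemma vint_linear:
  assumes L: "bounded_linear L" "\<And>v. L (K v) = K (L v)" and F: "vintegrable \<gamma> F"
  shows "vintegrable \<gamma> (\<lambda>z. L (F z))" and "vint \<gamma> (\<lambda>z. L (F z)) = L (vint \<gamma> F)"
proof -
  interpret L: bounded_linear L by fact
  have "L (act z v) = act z (L v)" for z v
    by (simp add: act_def L.add L.scaleR L(2))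
  then have "((\<lambda>t. act (vector_derivative \<gamma> (at t within {0..1})) (L (F (\<gamma> t))))
      has_integral L (vint \<gamma> F)) {0..1}"
    using has_integral_linear [OF integrable_integral L(1)] F
    by (fastforce simp: o_def vintegrable_def vint_def)
  then show "vintegrable \<gamma> (\<lambda>z. L (F z))" "vint \<gamma> (\<lambda>z. L (F z)) = L (vint \<gamma> F)"
    by (auto simp: vintegrable_def vint_def integrable_on_def integral_unique)
qed

lemma cfun_vint:
  assumes \<phi>: "bounded_linear \<phi>" and F: "vintegrable \<gamma> F"
  shows "((\<lambda>z. cfun \<phi> (F z)) has_contour_integral cfun \<phi> (vint \<gamma> F)) \<gamma>"
  unfolding has_contour_integral_def
  using has_integral_linear [OF integrable_integral bounded_linear_cfun [OF \<phi>]] F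
  by (fastforce simp: o_def vintegrable_def vint_def cfun_act [OF \<phi>] mult.commute)

text \<open>Caratheodory's criterion: the derivative is the value at \<open>z\<close> of a
  continuous slope. The resolvent equation supplies such a slope for \<open>R\<close>.\<close>

lemma cderivI_slope:
  assumes S: "open S" "z \<in> S" and F: "\<And>w. w \<in> S \<Longrightarrow> F w - F z = act (w - z) (c w)"
    and c: "isCont c z"
  shows "cderiv F (c z) z"
  unfolding cderiv_def has_derivative_at_alt
proof (intro conjI allI impI)
  show "bounded_linear (\<lambda>h. act h (c z))"
    by (rule act.bounded_linear_left)
  obtain M where M: "M > 0" "\<And>h v. norm (act h v) \<le> norm h * norm v * M"
    using act.pos_bounded by blast
  fix e :: real assume e: "e > 0"
  then obtain d where d: "d > 0" "\<And>w. dist w z < d \<Longrightarrow> dist (c w) (c z) < e / M"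
    using c M(1) by (metis continuous_at_eps_delta divide_pos_pos)
  obtain d' where d': "d' > 0" "ball z d' \<subseteq> S"
    using S openE by blast
  show "\<exists>d>0. \<forall>w. norm (w - z) < d \<longrightarrow> norm (F w - F z - act (w - z) (c z)) \<le> e * norm (w - z)"
  proof (intro exI [of _ "min d d'"] conjI allI impI)
    fix w assume w: "norm (w - z) < min d d'"
    then have "w \<in> S"
      using d'(2) by (auto simp: dist_norm norm_minus_commute)
    then have "norm (F w - F z - act (w - z) (c z)) = norm (act (w - z) (c w - c z))"
      by (simp add: F act.diff_right)
    also have "\<dots> \<le> norm (w - z) * norm (c w - c z) * M"
      by (rule M(2))
    also have "\<dots> \<le> norm (w - z) * (e / M) * M"
      using d(2) [of w] w M(1) by (intro mult_right_mono mult_left_mono) (auto simp: dist_norm)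
    finally show "norm (F w - F z - act (w - z) (c z)) \<le> e * norm (w - z)"
      using M(1) by (simp add: mult.commute)
  qed (use d d' in auto)
qed

end

section \<open>Cauchy-type integrals\<close>

text \<open>Differentiation under the integral uses a bound on the derivative of the path, which a
  valid path may lack near its corners. As \<open>h\<close> is holomorphic around the curve,
  \<open>\<gamma>\<close> can be replaced, near each \<open>w0\<close>, by a polynomial loop with
  the same integrals.\<close>

lemma cauchy_type_integral_holomorphic:
  assumes S: "open S" and h: "h holomorphic_on S" and \<gamma>: "valid_path \<gamma>" "path_image \<gamma> \<subseteq> S"
    "pathfinish \<gamma> = pathstart \<gamma>"
  shows "(\<lambda>w. contour_integral \<gamma> (\<lambda>z. h z / (z - w))) holomorphic_on - path_image \<gamma>"
proof -
  have "closed (path_image \<gamma>)"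
    using \<gamma>(1) by (rule closed_valid_path_image)
  then have op: "open (- path_image \<gamma>)"
    by (simp add: open_Compl)
  have "(\<lambda>w. contour_integral \<gamma> (\<lambda>z. h z / (z - w))) field_differentiable at w0"
    if w0: "w0 \<in> - path_image \<gamma>" for w0
  proof -
    obtain r where r: "r > 0" "cball w0 r \<subseteq> - path_image \<gamma>"
      using op w0 open_contains_cball by blast
    define S' where "S' = S - cball w0 r"
    have S': "open S'" "path_image \<gamma> \<subseteq> S'"
      using S r(2) \<gamma>(2) by (auto simp: S'_def)
    obtain d where d: "0 < d" "\<forall>g h. valid_path g \<and> valid_path h \<and>
        (\<forall>t\<in>{0..1}. norm (g t - \<gamma> t) < d \<and> norm (h t - \<gamma> t) < d) \<and>
        pathfinish g = pathstart g \<and> pathfinish h = pathstart h \<longrightarrow>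
        path_image g \<subseteq> S' \<and> path_image h \<subseteq> S' \<and>
        (\<forall>f. f holomorphic_on S' \<longrightarrow> contour_integral h f = contour_integral g f)"
      using contour_integral_nearby_loops [OF S'(1) valid_path_imp_path [OF \<gamma>(1)] S'(2)] by blast
    obtain p where p: "polynomial_function p" "pathstart p = pathstart \<gamma>" "pathfinish p = pathfinish \<gamma>"
      "\<And>t. t \<in> {0..1} \<Longrightarrow> norm (p t - \<gamma> t) < d"
      using path_approx_polynomial_function [OF valid_path_imp_path [OF \<gamma>(1)] d(1)] by blast
    have vp: "valid_path p"
      by (rule valid_path_polynomial_function [OF p(1)])
    have pS': "path_image p \<subseteq> S'"
      and eq: "\<And>f. f holomorphic_on S' \<Longrightarrow> contour_integral \<gamma> f = contour_integral p f"
      \<comment> \<open>\<open>\<gamma>\<close> is itself one of the loops within distance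
        \<open>d\<close>, so integrals over \<open>p\<close> and \<open>\<gamma>\<close>
        agree.\<close>
      using d(2) [rule_format, of p \<gamma>] vp p d(1) \<gamma> by (simp_all add: norm_minus_commute)
    obtain p' where p': "polynomial_function p'" "\<And>x. (p has_vector_derivative p' x) (at x)"
      using has_vector_derivative_polynomial_function [OF p(1)] by blast
    have "compact (p' ` {0..1})"
      by (intro compact_continuous_image continuous_on_polymonial_function p' compact_Icc)
    then obtain B where B: "\<And>t. t \<in> {0..1} \<Longrightarrow> norm (p' t) \<le> B"
      by (meson bounded_iff compact_imp_bounded image_eqI)
    have hol: "(\<lambda>z. h z / (z - w)) holomorphic_on S'" if "w \<in> ball w0 r" for w
      using that by (intro holomorphic_intros holomorphic_on_subset [OF h]) (auto simp: S'_def)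
    have int: "((\<lambda>z. h z / (z - w)) has_contour_integral contour_integral p (\<lambda>z. h z / (z - w))) p"
      if "w \<in> ball w0 r" for w
      by (intro has_contour_integral_integral contour_integrable_holomorphic_simple
          [OF hol S'(1) vp pS'] that)
    have "((\<lambda>w. contour_integral p (\<lambda>z. h z / (z - w))) has_field_derivative
        of_nat 1 * contour_integral p (\<lambda>u. h u / (u - w0) ^ Suc 1)) (at w0)"
    proof (rule Cauchy_next_derivative (2))
      show "continuous_on (path_image p) h"
        using pS' by (intro continuous_on_subset [OF holomorphic_on_imp_continuous_on [OF h]])
          (auto simp: S'_def)
      show "norm (vector_derivative p (at t)) \<le> B" if "t \<in> {0..1}" for t
        using B [OF that] vector_derivative_at [OF p'(2)] by simp
      show "w0 \<in> ball w0 r - path_image p"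
        using r(1) pS' by (auto simp: S'_def)
    qed (use int vp in auto)
    then have "((\<lambda>w. contour_integral \<gamma> (\<lambda>z. h z / (z - w))) has_field_derivative
        of_nat 1 * contour_integral p (\<lambda>u. h u / (u - w0) ^ Suc 1)) (at w0)"
      by (rule has_field_derivative_transform_within_open [where S = "ball w0 r"])
        (use r(1) eq [OF hol] in auto)
    then show ?thesis
      by (auto simp: field_differentiable_def)
  qed
  then show ?thesis
    using op by (simp add: holomorphic_on_def field_differentiable_at_within)
qed

section \<open>Inverses of bounded operators\<close>

lemma blinfun_compose_assoc: "(A o\<^sub>L B) o\<^sub>L C = A o\<^sub>L (B o\<^sub>L C)"
  by (rule blinfun_eqI) simp

lemma blinfun_compose_id [simp]: "id_blinfun o\<^sub>L A = A" "A o\<^sub>L id_blinfun = A"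
  by (rule blinfun_eqI, simp)+

interpretation blinfun_compose: bounded_bilinear "(o\<^sub>L)"
  by (rule bounded_bilinear_blinfun_compose)

lemmas blinfun_compose_simps =
  blinfun_compose.add_left blinfun_compose.add_right blinfun_compose.diff_left
  blinfun_compose.diff_right blinfun_compose.minus_left blinfun_compose.minus_right
  blinfun_compose.scaleR_left blinfun_compose.scaleR_right blinfun_compose_assoc

text \<open>In contrast to \<open>is_op_inverse\<close>, this makes sense on any Banach space; for
  operators in \<open>BX\<close>, \<open>inverse_ops_BX\<close> supplies the right
  linearity.\<close>

definition inverse_ops :: "('v::real_normed_vector \<Rightarrow>\<^sub>L 'v) \<Rightarrow> ('v \<Rightarrow>\<^sub>L 'v) \<Rightarrow> bool" where
  "inverse_ops A B \<longleftrightarrow> A o\<^sub>L B = id_blinfun \<and> B o\<^sub>L A = id_blinfun"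

lemma inverse_ops_unique:
  assumes "inverse_ops A B" "inverse_ops A C"
  shows "B = C"
  using assms unfolding inverse_ops_def by (metis blinfun_compose_assoc blinfun_compose_id)

lemma inverse_ops_commute:
  assumes "inverse_ops A B" "C o\<^sub>L A = A o\<^sub>L C"
  shows "C o\<^sub>L B = B o\<^sub>L C"
proof -
  have "B o\<^sub>L (C o\<^sub>L A) o\<^sub>L B = B o\<^sub>L (A o\<^sub>L C) o\<^sub>L B"
    using assms(2) by simp
  then show ?thesis
    using assms(1) unfolding inverse_ops_def by (metis blinfun_compose_assoc blinfun_compose_id)
qed

text \<open>The Neumann series in the form of Banach's fixed point theorem: the contractions
  \<open>B \<mapsto> 1 + E B\<close> and \<open>B \<mapsto> 1 + B E\<close> yield a right and a left
  inverse, which coincide. The bound 2 comes from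
  \<open>norm B \<le> 1 + norm B / 2\<close>.\<close>

lemma id_minus_inverse:
  fixes E :: "'v::banach \<Rightarrow>\<^sub>L 'v"
  assumes E: "norm E \<le> 1 / 2"
  obtains B where "inverse_ops (id_blinfun - E) B" "norm B \<le> 2"
proof -
  have "\<exists>!B. id_blinfun + (E o\<^sub>L B) = B"
  proof (rule banach_fix_type [where c = "1/2"])
    have "dist (id_blinfun + (E o\<^sub>L x)) (id_blinfun + (E o\<^sub>L y)) \<le> 1/2 * dist x y" for x y :: "'v \<Rightarrow>\<^sub>L 'v"
    proof -
      have "dist (id_blinfun + (E o\<^sub>L x)) (id_blinfun + (E o\<^sub>L y)) = norm (E o\<^sub>L (x - y))"
        by (simp add: dist_norm blinfun_compose_simps)
      also have "\<dots> \<le> 1/2 * dist x y"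
        unfolding dist_norm using E
        by (intro order_trans [OF norm_blinfun_compose] mult_right_mono) auto
      finally show ?thesis
        by simp
    qed
    then show "\<forall>x y. dist (id_blinfun + (E o\<^sub>L x)) (id_blinfun + (E o\<^sub>L y)) \<le> 1/2 * dist x y"
      by blast
  qed simp_all
  then obtain B where B: "id_blinfun + (E o\<^sub>L B) = B" by blast
  have "\<exists>!B. id_blinfun + (B o\<^sub>L E) = B"
  proof (rule banach_fix_type [where c = "1/2"])
    have "dist (id_blinfun + (x o\<^sub>L E)) (id_blinfun + (y o\<^sub>L E)) \<le> 1/2 * dist x y" for x y :: "'v \<Rightarrow>\<^sub>L 'v"
    proof -
      have "dist (id_blinfun + (x o\<^sub>L E)) (id_blinfun + (y o\<^sub>L E)) = norm ((x - y) o\<^sub>L E)"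
        by (simp add: dist_norm blinfun_compose_simps)
      also have "\<dots> \<le> dist x y * (1/2)"
        unfolding dist_norm using E
        by (intro order_trans [OF norm_blinfun_compose] mult_left_mono) auto
      finally show ?thesis
        by simp
    qed
    then show "\<forall>x y. dist (id_blinfun + (x o\<^sub>L E)) (id_blinfun + (y o\<^sub>L E)) \<le> 1/2 * dist x y"
      by blast
  qed simp_all
  then obtain B' where B': "id_blinfun + (B' o\<^sub>L E) = B'" by blast
  have 1: "(id_blinfun - E) o\<^sub>L B = id_blinfun" "B' o\<^sub>L (id_blinfun - E) = id_blinfun"
    using B B' by (simp_all add: blinfun_compose_simps algebra_simps)
  then have "B' = B"
    by (metis blinfun_compose_assoc blinfun_compose_id)
  then have "inverse_ops (id_blinfun - E) B"
    using 1 by (simp add: inverse_ops_def)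
  moreover have "norm B \<le> norm (id_blinfun :: 'v \<Rightarrow>\<^sub>L 'v) + norm E * norm B"
    by (subst B [symmetric]) (intro order_trans [OF norm_triangle_ineq] add_left_mono norm_blinfun_compose)
  then have "norm B \<le> 1 + 1/2 * norm B"
    using norm_blinfun_id_le [where 'a = 'v] mult_right_mono [OF E, of "norm B"] by force
  ultimately show ?thesis
    using that by simp
qed

text \<open>Factor \<open>A - C = A (1 - B C)\<close> and invert the second factor.\<close>

lemma inverse_ops_perturb:
  fixes A B C :: "'v::banach \<Rightarrow>\<^sub>L 'v"
  assumes "inverse_ops A B" and le: "norm B * norm C \<le> 1 / 2"
  obtains B' where "inverse_ops (A - C) B'" "norm B' \<le> 2 * norm B"
proof -
  have AB: "A o\<^sub>L B = id_blinfun" "B o\<^sub>L A = id_blinfun"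
    using assms(1) by (auto simp: inverse_ops_def)
  obtain D where D: "inverse_ops (id_blinfun - (B o\<^sub>L C)) D" "norm D \<le> 2"
    using id_minus_inverse [of "B o\<^sub>L C"] order_trans [OF norm_blinfun_compose le] by blast
  have fac: "A - C = A o\<^sub>L (id_blinfun - (B o\<^sub>L C))"
    by (simp add: blinfun_compose.diff_right blinfun_compose_assoc [symmetric] AB)
  have "inverse_ops (A - C) (D o\<^sub>L B)"
    unfolding inverse_ops_def
  proof
    have "(A - C) o\<^sub>L (D o\<^sub>L B) = A o\<^sub>L ((id_blinfun - (B o\<^sub>L C)) o\<^sub>L D) o\<^sub>L B"
      unfolding fac by (simp only: blinfun_compose_assoc)
    then show "(A - C) o\<^sub>L (D o\<^sub>L B) = id_blinfun"
      using D(1) AB by (simp add: inverse_ops_def)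
    have "(D o\<^sub>L B) o\<^sub>L (A - C) = D o\<^sub>L (B o\<^sub>L A) o\<^sub>L (id_blinfun - (B o\<^sub>L C))"
      unfolding fac by (simp only: blinfun_compose_assoc)
    then show "(D o\<^sub>L B) o\<^sub>L (A - C) = id_blinfun"
      using D(1) AB by (simp add: inverse_ops_def)
  qed
  moreover have "norm (D o\<^sub>L B) \<le> 2 * norm B"
    by (intro order_trans [OF norm_blinfun_compose] mult_right_mono D(2) norm_ge_zero)
  ultimately show ?thesis
    using that by blast
qed

section \<open>Quadratic operator pencils\<close>

lemma compose_commute:
  assumes "A o\<^sub>L C = C o\<^sub>L A" "B o\<^sub>L C = C o\<^sub>L B"
  shows "(A o\<^sub>L B) o\<^sub>L C = C o\<^sub>L (A o\<^sub>L B)"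
proof -
  have "(A o\<^sub>L B) o\<^sub>L C = A o\<^sub>L (C o\<^sub>L B)"
    by (simp add: blinfun_compose_assoc assms(2))
  also have "\<dots> = C o\<^sub>L (A o\<^sub>L B)"
    by (simp add: blinfun_compose_assoc [symmetric] assms(1))
  finally show ?thesis .
qed

text \<open>To be used with \<open>I\<close> as left multiplication by \<open>J\<close>,
  \<open>S\<close> as \<open>T\<^sub>0\<close> and \<open>N\<close> as \<open>T T'\<close>.\<close>

locale quadratic_pencil =
  fixes I S N :: "'v::banach \<Rightarrow>\<^sub>L 'v"
  assumes I_I: "I o\<^sub>L I = - id_blinfun"
    and IS: "I o\<^sub>L S = S o\<^sub>L I" and IN: "I o\<^sub>L N = N o\<^sub>L I" and SN: "S o\<^sub>L N = N o\<^sub>L S"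
begin

sublocale complex_structure "\<lambda>A :: 'v \<Rightarrow>\<^sub>L 'v. I o\<^sub>L A"
proof (rule complex_structure.intro)
  show "bounded_linear (\<lambda>A :: 'v \<Rightarrow>\<^sub>L 'v. I o\<^sub>L A)"
    by (rule blinfun_compose.bounded_linear_right)
  show "I o\<^sub>L (I o\<^sub>L A) = - A" for A :: "'v \<Rightarrow>\<^sub>L 'v"
    by (simp add: blinfun_compose_assoc [symmetric] I_I blinfun_compose.minus_left)
qed

definition emb :: "complex \<Rightarrow> 'v \<Rightarrow>\<^sub>L 'v" where
  "emb z = Re z *\<^sub>R id_blinfun + Im z *\<^sub>R I"

definition Q :: "complex \<Rightarrow> 'v \<Rightarrow>\<^sub>L 'v" where
  "Q z = (emb z o\<^sub>L emb z) - 2 *\<^sub>R (emb z o\<^sub>L S) + N"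

definition resolvent_set :: "complex set" where
  "resolvent_set = {z. \<exists>B. inverse_ops (Q z) B}"

text \<open>The choice is arbitrary off \<open>resolvent_set\<close>, which is why
  \<open>cint_cong\<close> compares integrands only on that set.\<close>

definition R :: "complex \<Rightarrow> 'v \<Rightarrow>\<^sub>L 'v" where
  "R z = (SOME B. inverse_ops (Q z) B)"

text \<open>The commutant of \<open>I\<close>, \<open>S\<close> and \<open>N\<close>. Two such
  operators need not commute with each other, but each commutes with every \<open>emb z\<close> and
  \<open>Q z\<close>, and with \<open>R z\<close> for \<open>z\<close> in
  \<open>resolvent_set\<close>.\<close>

definition central :: "('v \<Rightarrow>\<^sub>L 'v) \<Rightarrow> bool" where
  "central C \<longleftrightarrow> C o\<^sub>L I = I o\<^sub>L C \<and> C o\<^sub>L S = S o\<^sub>L C \<and> C o\<^sub>L N = N o\<^sub>L C"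

lemma act_eq: "act z A = emb z o\<^sub>L A"
  by (simp add: act_def emb_def blinfun_compose_simps)

lemma bounded_linear_emb: "bounded_linear emb"
  using act.bounded_linear_left [of id_blinfun] by (simp add: act_eq)

sublocale emb: bounded_linear emb
  by (rule bounded_linear_emb)

lemma emb_mult: "emb (z * w) = emb z o\<^sub>L emb w"
  using act_mult [of z w id_blinfun] by (simp add: act_eq)

lemma emb_one [simp]: "emb 1 = id_blinfun"
  by (simp add: emb_def)

lemma emb_commute: "C o\<^sub>L I = I o\<^sub>L C \<Longrightarrow> C o\<^sub>L emb z = emb z o\<^sub>L C"
  by (simp add: emb_def blinfun_compose_simps)

lemma central_I: "central I" and central_S: "central S" and central_N: "central N"
  and central_id: "central id_blinfun"
  by (simp_all add: central_def IS IN SN)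

lemma central_add: "central A \<Longrightarrow> central B \<Longrightarrow> central (A + B)"
  and central_diff: "central A \<Longrightarrow> central B \<Longrightarrow> central (A - B)"
  and central_scaleR: "central A \<Longrightarrow> central (r *\<^sub>R A)"
  by (simp_all add: central_def blinfun_compose_simps)

lemma central_compose: "central A \<Longrightarrow> central B \<Longrightarrow> central (A o\<^sub>L B)"
  by (simp add: central_def compose_commute)

lemma central_emb: "central (emb z)"
  unfolding emb_def by (intro central_add central_scaleR central_id central_I)

lemma central_emb_commute: "central C \<Longrightarrow> C o\<^sub>L emb z = emb z o\<^sub>L C"
  by (rule emb_commute) (simp add: central_def)

lemma central_Q_commute:
  assumes "central C"
  shows "C o\<^sub>L Q z = Q z o\<^sub>L C"
proof -
  have "C o\<^sub>L (emb z o\<^sub>L emb z) = (emb z o\<^sub>L emb z) o\<^sub>L C"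
    "C o\<^sub>L (emb z o\<^sub>L S) = (emb z o\<^sub>L S) o\<^sub>L C"
    using assms central_emb_commute [OF assms, of z]
    by (simp_all add: central_def compose_commute [symmetric])
  then show ?thesis
    using assms by (simp add: Q_def central_def blinfun_compose.add_left blinfun_compose.add_right
        blinfun_compose.diff_left blinfun_compose.diff_right blinfun_compose.scaleR_left
        blinfun_compose.scaleR_right)
qed

lemma inverse_R: "z \<in> resolvent_set \<Longrightarrow> inverse_ops (Q z) (R z)"
  unfolding resolvent_set_def R_def by (auto intro: someI_ex)

lemma Q_R: "z \<in> resolvent_set \<Longrightarrow> Q z o\<^sub>L R z = id_blinfun"
  and R_Q: "z \<in> resolvent_set \<Longrightarrow> R z o\<^sub>L Q z = id_blinfun"
  using inverse_R by (auto simp: inverse_ops_def)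

lemma central_R_commute: "z \<in> resolvent_set \<Longrightarrow> central C \<Longrightarrow> C o\<^sub>L R z = R z o\<^sub>L C"
  using inverse_ops_commute [OF inverse_R central_Q_commute] .

lemma central_R: "z \<in> resolvent_set \<Longrightarrow> central (R z)"
  using central_R_commute central_I central_S central_N unfolding central_def [of "R z"] by metis

section \<open>The resolvent equation, holomorphy and decay of the inverse pencil\<close>

lemma Q_diff: "Q w - Q z = emb (w - z) o\<^sub>L (emb (z + w) - 2 *\<^sub>R S)"
proof -
  have "emb (w - z) o\<^sub>L emb (z + w) = (emb w o\<^sub>L emb w) - (emb z o\<^sub>L emb z)"
    by (simp add: emb_mult [symmetric] emb.diff [symmetric] algebra_simps)
  then show ?thesis
    by (simp add: Q_def emb.diff blinfun_compose_simps algebra_simps)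
qed

text \<open>This is \<open>R z - R w = R z (Q w - Q z) R w\<close> with the scalar factor pulled
  out. The split-off \<open>z - w\<close> serves twice: as the increment in \<open>cderiv_R\<close>
  and to cancel the Cauchy kernel in \<open>cauchy_transform_R\<close>.\<close>

lemma R_diff:
  assumes z: "z \<in> resolvent_set" and w: "w \<in> resolvent_set"
  shows "R z - R w = act (z - w) (R z o\<^sub>L ((2 *\<^sub>R S - emb (z + w)) o\<^sub>L R w))"
proof -
  have "R z o\<^sub>L ((Q w - Q z) o\<^sub>L R w) = (R z o\<^sub>L (Q w o\<^sub>L R w)) - ((R z o\<^sub>L Q z) o\<^sub>L R w)"
    by (simp add: blinfun_compose.diff_left blinfun_compose.diff_right blinfun_compose_assoc)
  then have "R z - R w = R z o\<^sub>L ((Q w - Q z) o\<^sub>L R w)"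
    using Q_R [OF w] R_Q [OF z] by simp
  also have "\<dots> = (R z o\<^sub>L emb (w - z)) o\<^sub>L ((emb (z + w) - 2 *\<^sub>R S) o\<^sub>L R w)"
    by (simp add: Q_diff blinfun_compose_assoc)
  also have "\<dots> = emb (w - z) o\<^sub>L (R z o\<^sub>L ((emb (z + w) - 2 *\<^sub>R S) o\<^sub>L R w))"
    by (simp add: central_emb_commute central_R z blinfun_compose_assoc)
  also have "\<dots> = emb (z - w) o\<^sub>L (R z o\<^sub>L ((2 *\<^sub>R S - emb (z + w)) o\<^sub>L R w))"
    by (simp add: emb.diff blinfun_compose.diff_left blinfun_compose.diff_right)
  finally show ?thesis
    by (simp add: act_eq)
qed

text \<open>\<open>Q w\<close> is a small perturbation of \<open>Q z\<close>. The bound on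
  \<open>R w\<close> prepares \<open>isCont_R\<close>, where the resolvent equation still contains
  \<open>R w\<close>.\<close>

lemma R_locally_bounded:
  assumes z: "z \<in> resolvent_set"
  obtains d where "d > 0"
    "\<And>w. w \<in> ball z d \<Longrightarrow> w \<in> resolvent_set \<and> norm (R w) \<le> 2 * norm (R z)"
proof -
  have "((\<lambda>w. norm (R z) * norm (Q z - Q w)) \<longlongrightarrow>
      norm (R z) * norm (emb (z - z) o\<^sub>L (emb (z + z) - 2 *\<^sub>R S))) (at z)"
    unfolding Q_diff
    by (intro tendsto_intros blinfun_compose.tendsto emb.tendsto)
  then have "((\<lambda>w. norm (R z) * norm (Q z - Q w)) \<longlongrightarrow> 0) (at z)"
    by (simp add: emb.zero blinfun_compose.zero_left)
  then have "\<forall>\<^sub>F w in at z. norm (R z) * norm (Q z - Q w) < 1 / 2"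
    by (rule order_tendstoD) simp
  then obtain d where d: "d > 0"
    "\<And>w. w \<noteq> z \<Longrightarrow> dist w z < d \<Longrightarrow> norm (R z) * norm (Q z - Q w) < 1 / 2"
    by (auto simp: eventually_at)
  show ?thesis
  proof (rule that [OF d(1)])
    fix w assume w: "w \<in> ball z d"
    have "norm (R z) * norm (Q z - Q w) \<le> 1 / 2"
      using d(2) [of w] w by (cases "w = z") (auto simp: dist_commute)
    then obtain B where B: "inverse_ops (Q z - (Q z - Q w)) B" "norm B \<le> 2 * norm (R z)"
      using inverse_ops_perturb [OF inverse_R [OF z]] by blast
    then have w': "w \<in> resolvent_set"
      by (auto simp: resolvent_set_def)
    moreover have "R w = B"
      using inverse_ops_unique [OF inverse_R [OF w']] B(1) by simp
    ultimately show "w \<in> resolvent_set \<and> norm (R w) \<le> 2 * norm (R z)"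
      using B(2) by simp
  qed
qed

lemma open_resolvent_set: "open resolvent_set"
  unfolding open_contains_ball by (meson R_locally_bounded subsetI)

lemma isCont_R:
  assumes z: "z \<in> resolvent_set"
  shows "isCont R z"
proof -
  obtain d where d: "d > 0"
    "\<And>w. w \<in> ball z d \<Longrightarrow> w \<in> resolvent_set \<and> norm (R w) \<le> 2 * norm (R z)"
    using R_locally_bounded [OF z] by blast
  define g where "g w = norm (emb (w - z)) *
    (2 * norm (R z) * (norm (2 *\<^sub>R S - emb (w + z)) * norm (R z)))" for w
  have le: "norm (R w - R z) \<le> g w" if w: "w \<in> ball z d" for w
  proof -
    have "R w - R z = emb (w - z) o\<^sub>L (R w o\<^sub>L ((2 *\<^sub>R S - emb (w + z)) o\<^sub>L R z))"
      using R_diff [of w z] d(2) [OF w] z by (simp add: act_eq)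
    also have "norm \<dots> \<le> g w"
      unfolding g_def using d(2) [OF w]
      by (intro order_trans [OF norm_blinfun_compose] mult_left_mono mult_mono) auto
    finally show ?thesis .
  qed
  have "(g \<longlongrightarrow> norm (emb (z - z)) * (2 * norm (R z) * (norm (2 *\<^sub>R S - emb (z + z)) * norm (R z)))) (at z)"
    unfolding g_def by (intro tendsto_intros emb.tendsto)
  then have "(g \<longlongrightarrow> 0) (at z)"
    by (simp add: emb.zero)
  moreover have "\<forall>\<^sub>F w in at z. norm (R w - R z) \<le> g w"
    using le d(1) by (auto simp: eventually_at dist_commute intro!: exI [of _ d])
  ultimately have "((\<lambda>w. R w - R z) \<longlongrightarrow> 0) (at z)"
    by (rule Lim_null_comparison [rotated])
  then show ?thesis
    by (simp add: isCont_def LIM_zero_iff)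
qed

lemma cderiv_R:
  assumes z: "z \<in> resolvent_set"
  shows "cderiv R (2 *\<^sub>R ((S - emb z) o\<^sub>L (R z o\<^sub>L R z))) z"
proof -
  have "cderiv R (R z o\<^sub>L ((2 *\<^sub>R S - emb (z + z)) o\<^sub>L R z)) z"
  proof (rule cderivI_slope [where c = "\<lambda>w. R w o\<^sub>L ((2 *\<^sub>R S - emb (w + z)) o\<^sub>L R z)",
        OF open_resolvent_set z])
    show "R w - R z = act (w - z) (R w o\<^sub>L ((2 *\<^sub>R S - emb (w + z)) o\<^sub>L R z))"
      if "w \<in> resolvent_set" for w
      by (rule R_diff [OF that z])
    show "isCont (\<lambda>w. R w o\<^sub>L ((2 *\<^sub>R S - emb (w + z)) o\<^sub>L R z)) z"
      unfolding isCont_def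
      by (intro tendsto_intros blinfun_compose.tendsto emb.tendsto isCont_R [OF z, unfolded isCont_def])
  qed
  moreover have "R z o\<^sub>L (S - emb z) = (S - emb z) o\<^sub>L R z"
    by (intro central_R_commute [OF z, symmetric] central_diff central_S central_emb)
  then have "R z o\<^sub>L ((S - emb z) o\<^sub>L R z) = (S - emb z) o\<^sub>L (R z o\<^sub>L R z)"
    by (simp add: blinfun_compose_assoc [symmetric])
  moreover have "2 *\<^sub>R S - emb (z + z) = 2 *\<^sub>R (S - emb z)"
    by (simp only: emb.add scaleR_2 scaleR_diff_right)
  ultimately show ?thesis
    by (simp add: blinfun_compose.scaleR_left blinfun_compose.scaleR_right)
qed

lemma R_decay:
  obtains C r where "r > 0" "\<And>w. r \<le> norm w \<Longrightarrow> w \<in> resolvent_set \<and> norm (R w) \<le> C / (norm w)\<^sup>2"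
proof -
  obtain M where M: "M > 0" "\<And>z. norm (emb z) \<le> norm z * M"
    using emb.pos_bounded by blast
  define a where "a = 2 * M * norm S + norm N"
  have a: "a \<ge> 0"
    using M(1) by (simp add: a_def)
  show ?thesis
  \<comment> \<open>The summand 1 gives \<open>norm w \<ge> 1\<close>, so that \<open>norm N\<close>
    is absorbed into \<open>norm w * a\<close>; the summand \<open>2 * M * a\<close> makes
    \<open>E\<close>, the lower order part of \<open>Q w\<close>, admissible for
    \<open>inverse_ops_perturb\<close>, whose factor 2 reappears in the decay constant.\<close>
  proof (rule that [of "1 + 2 * M * a" "2 * M"])
    show "1 + 2 * M * a > 0"
      using a M(1) by (simp add: add_pos_nonneg)
    fix w :: complex assume w: "1 + 2 * M * a \<le> norm w"
    have w1: "norm w \<ge> 1" and w2: "2 * M * a \<le> norm w"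
      using w mult_nonneg_nonneg [of M a] a M(1) by linarith+
    then have "w \<noteq> 0" by auto
    define c where "c = inverse (w * w)"
    have inv: "inverse_ops (emb (w * w)) (emb c)"
      using right_inverse [of "w * w"] left_inverse [of "w * w"] \<open>w \<noteq> 0\<close>
      unfolding inverse_ops_def c_def emb_mult [symmetric] by (simp del: inverse_mult_distrib)
    have nc: "norm (emb c) \<le> M / (norm w)\<^sup>2"
      using M(2) [of c] by (simp add: c_def norm_inverse norm_mult power2_eq_square divide_inverse mult.commute)
    define E where "E = 2 *\<^sub>R (emb w o\<^sub>L S) - N"
    have "norm E \<le> 2 * (norm w * M * norm S) + norm N"
      unfolding E_def
      by (intro order_trans [OF norm_triangle_ineq4] add_mono order_refl)
        (auto intro!: order_trans [OF norm_blinfun_compose] mult_right_mono M)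
    also have "\<dots> \<le> norm w * a"
      using w1 mult_right_mono [of 1 "norm w" "norm N"] by (simp add: a_def algebra_simps)
    finally have nE: "norm E \<le> norm w * a" .
    have "norm (emb c) * norm E \<le> M / (norm w)\<^sup>2 * (norm w * a)"
      using M(1) by (intro mult_mono nc nE) auto
    also have "\<dots> = (M * a) / norm w"
      using \<open>w \<noteq> 0\<close> by (simp add: power2_eq_square)
    also have "\<dots> \<le> 1 / 2"
      using w1 w2 \<open>w \<noteq> 0\<close> by (simp add: field_simps)
    finally obtain B where B: "inverse_ops (emb (w * w) - E) B" "norm B \<le> 2 * norm (emb c)"
      using inverse_ops_perturb [OF inv] by blast
    have "Q w = emb (w * w) - E"
      by (simp add: Q_def E_def emb_mult)
    then have w': "w \<in> resolvent_set" and "inverse_ops (Q w) B"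
      using B(1) by (auto simp: resolvent_set_def)
    then have "R w = B"
      using inverse_ops_unique inverse_R by blast
    then show "w \<in> resolvent_set \<and> norm (R w) \<le> 2 * M / (norm w)\<^sup>2"
      using w' B(2) nc by simp
  qed
qed

lemma cderiv_emb:
  assumes "(f has_field_derivative f') (at z)"
  shows "cderiv (\<lambda>z. emb (f z)) (emb f') z"
proof -
  have "((\<lambda>z. emb (f z)) has_derivative (\<lambda>h. emb (f' * h))) (at z)"
    by (rule emb.has_derivative [OF has_field_derivative_imp_has_derivative [OF assms]])
  then show ?thesis
    by (simp add: cderiv_def act_eq emb_mult [symmetric] mult.commute)
qed

text \<open>The increment \<open>emb h\<close> arising from \<open>G\<close> has to move past
  \<open>F z\<close>, hence the condition that \<open>F z\<close> commutes with
  \<open>I\<close>.\<close>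

lemma cderiv_compose:
  assumes "cderiv F F' z" "cderiv G G' z" "F z o\<^sub>L I = I o\<^sub>L F z"
  shows "cderiv (\<lambda>z. F z o\<^sub>L G z) ((F z o\<^sub>L G') + (F' o\<^sub>L G z)) z"
proof -
  have "((\<lambda>z. F z o\<^sub>L G z) has_derivative
      (\<lambda>h. (F z o\<^sub>L (emb h o\<^sub>L G')) + ((emb h o\<^sub>L F') o\<^sub>L G z))) (at z)"
    using assms(1,2) unfolding cderiv_def act_eq by (rule blinfun_compose.FDERIV)
  moreover have "F z o\<^sub>L (emb h o\<^sub>L G') = emb h o\<^sub>L (F z o\<^sub>L G')" for h
    using emb_commute [OF assms(3)] by (metis blinfun_compose_assoc)
  ultimately show ?thesis
    by (simp add: cderiv_def act_eq blinfun_compose.add_right blinfun_compose_assoc)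
qed

end

section \<open>Moments of the inverse pencil over a cycle around its spectrum\<close>

locale pencil_cycle = quadratic_pencil I S N
  for I S N :: "'v::banach \<Rightarrow>\<^sub>L 'v" +
  fixes \<Gamma> :: "(real \<Rightarrow> complex) set" and D :: "complex set"
  assumes finite_cycle: "finite \<Gamma>"
    and valid_cycle: "\<gamma> \<in> \<Gamma> \<Longrightarrow> valid_path \<gamma>"
    and closed_cycle: "\<gamma> \<in> \<Gamma> \<Longrightarrow> pathfinish \<gamma> = pathstart \<gamma>"
    and open_D: "open D" and bounded_D: "bounded D"
    and compl_D: "- D \<subseteq> resolvent_set"
    and disjoint_D: "\<gamma> \<in> \<Gamma> \<Longrightarrow> path_image \<gamma> \<inter> D = {}"
    and winding_D: "z \<in> D \<Longrightarrow> (\<Sum>\<gamma>\<in>\<Gamma>. winding_number \<gamma> z) = 1"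
begin

definition G :: "nat \<Rightarrow> complex \<Rightarrow> 'v \<Rightarrow>\<^sub>L 'v" where
  "G k z = emb (z ^ k) o\<^sub>L R z"

text \<open>\<open>- 2 X k\<close> is \<open>z\<^sup>k\<close> times the derivative of
  \<open>R\<close>; the kernel of the theorem is a combination of such terms.\<close>

definition X :: "nat \<Rightarrow> complex \<Rightarrow> 'v \<Rightarrow>\<^sub>L 'v" where
  "X k z = emb (z ^ k) o\<^sub>L ((emb z - S) o\<^sub>L (R z o\<^sub>L R z))"

definition cintegrable :: "(complex \<Rightarrow> 'v \<Rightarrow>\<^sub>L 'v) \<Rightarrow> bool" where
  "cintegrable F \<longleftrightarrow> (\<forall>\<gamma>\<in>\<Gamma>. vintegrable \<gamma> F)"

definition cint :: "(complex \<Rightarrow> 'v \<Rightarrow>\<^sub>L 'v) \<Rightarrow> 'v \<Rightarrow>\<^sub>L 'v" where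
  "cint F = (\<Sum>\<gamma>\<in>\<Gamma>. vint \<gamma> F)"

text \<open>The moment without the factor \<open>- J / (2 pi)\<close>, which is restored in
  \<open>P2_integral\<close>.\<close>

definition V :: "nat \<Rightarrow> 'v \<Rightarrow>\<^sub>L 'v" where
  "V k = cint (G k)"

lemma path_image_subset: "\<gamma> \<in> \<Gamma> \<Longrightarrow> path_image \<gamma> \<subseteq> resolvent_set"
  using compl_D disjoint_D by blast

lemma cint_cong:
  assumes "\<And>z. z \<in> resolvent_set \<Longrightarrow> F z = F' z"
  shows "cint F = cint F'" and "cintegrable F \<longleftrightarrow> cintegrable F'"
proof -
  have "vint \<gamma> F = vint \<gamma> F'" "vintegrable \<gamma> F \<longleftrightarrow> vintegrable \<gamma> F'" if "\<gamma> \<in> \<Gamma>" for \<gamma>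
    using assms path_image_subset [OF that] by (auto intro!: vint_cong vintegrable_cong)
  then show "cint F = cint F'" "cintegrable F \<longleftrightarrow> cintegrable F'"
    by (auto simp: cint_def cintegrable_def intro: sum.cong)
qed

lemma cintegrable_cderiv:
  assumes "\<And>z. z \<in> resolvent_set \<Longrightarrow> cderiv F (F' z) z"
  shows "cintegrable F"
  unfolding cintegrable_def
  using vintegrable_cderiv [OF valid_cycle open_resolvent_set path_image_subset assms] by blast

lemma cint_closed:
  assumes "\<And>z. z \<in> resolvent_set \<Longrightarrow> cderiv F (F' z) z"
  shows "cintegrable F'" and "cint F' = 0"
proof -
  have "vintegrable \<gamma> F'" "vint \<gamma> F' = 0" if "\<gamma> \<in> \<Gamma>" for \<gamma>
    using vint_cderiv_closed [OF valid_cycle closed_cycle, OF that that, of F F']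
      path_image_subset [OF that] assms by blast+
  then show "cintegrable F'" "cint F' = 0"
    by (auto simp: cint_def cintegrable_def)
qed

lemma cint_diff:
  assumes "cintegrable F" "cintegrable F'"
  shows "cintegrable (\<lambda>z. F z - F' z)" and "cint (\<lambda>z. F z - F' z) = cint F - cint F'"
  using assms vintegrable_diff vint_diff
  by (auto simp: cint_def cintegrable_def sum_subtractf [symmetric] intro!: sum.cong)

lemma cint_linear:
  assumes L: "bounded_linear L" "\<And>A. L (I o\<^sub>L A) = I o\<^sub>L L A" and F: "cintegrable F"
  shows "cintegrable (\<lambda>z. L (F z))" and "cint (\<lambda>z. L (F z)) = L (cint F)"
proof -
  have *: "vintegrable \<gamma> (\<lambda>z. L (F z))" "vint \<gamma> (\<lambda>z. L (F z)) = L (vint \<gamma> F)" if "\<gamma> \<in> \<Gamma>" for \<gamma>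
    using vint_linear [OF L] F that by (auto simp: cintegrable_def)
  then show "cintegrable (\<lambda>z. L (F z))"
    by (simp add: cintegrable_def)
  show "cint (\<lambda>z. L (F z)) = L (cint F)"
    by (simp add: cint_def linear_sum [OF bounded_linear.linear [OF L(1)]] *)
qed

text \<open>Commuting with \<open>C\<close> means vanishing of the commutator, a bounded linear map
  that commutes with \<open>I\<close> as soon as \<open>C\<close> does, so it can be taken inside
  the integral.\<close>

lemma central_cint:
  assumes "cintegrable F" "\<And>z. z \<in> resolvent_set \<Longrightarrow> central (F z)"
  shows "central (cint F)"
proof -
  have *: "cint F o\<^sub>L C = C o\<^sub>L cint F"
    if C: "C o\<^sub>L I = I o\<^sub>L C" and comm: "\<And>z. z \<in> resolvent_set \<Longrightarrow> F z o\<^sub>L C = C o\<^sub>L F z" for C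
  proof -
    let ?L = "\<lambda>A. (A o\<^sub>L C) - (C o\<^sub>L A)"
    have "bounded_linear ?L"
      by (intro bounded_linear_sub blinfun_compose.bounded_linear_left
          blinfun_compose.bounded_linear_right)
    moreover have "C o\<^sub>L (I o\<^sub>L A) = I o\<^sub>L (C o\<^sub>L A)" for A
      using C by (metis blinfun_compose_assoc)
    then have "?L (I o\<^sub>L A) = I o\<^sub>L ?L A" for A
      by (simp add: blinfun_compose_assoc blinfun_compose.diff_right)
    ultimately have "?L (cint F) = cint (\<lambda>z. ?L (F z))"
      using cint_linear (2) [OF _ _ assms(1), of ?L] by simp
    also have "\<dots> = cint (\<lambda>z. 0)"
      using comm by (intro cint_cong) simp
    finally show ?thesis
      by (simp add: cint_def vint_def act.zero_right)
  qed
  show ?thesis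
    unfolding central_def using assms(2)
    by (intro conjI * refl) (simp_all add: central_def IS IN)
qed

text \<open>The product rule. For \<open>k = 0\<close> the truncated \<open>k - 1\<close> does no
  harm, as its coefficient is zero.\<close>

lemma cderiv_G:
  assumes z: "z \<in> resolvent_set"
  shows "cderiv (G k) (real k *\<^sub>R G (k - 1) z - 2 *\<^sub>R X k z) z"
proof -
  have "((\<lambda>z. z ^ k) has_field_derivative of_nat k * z ^ (k - 1)) (at z)"
    by (auto intro!: derivative_eq_intros)
  from cderiv_compose [OF cderiv_emb [OF this] cderiv_R [OF z]]
  have "cderiv (G k) ((emb (z ^ k) o\<^sub>L 2 *\<^sub>R ((S - emb z) o\<^sub>L (R z o\<^sub>L R z))) +
      (emb (of_nat k * z ^ (k - 1)) o\<^sub>L R z)) z"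
    using central_emb by (simp add: G_def [abs_def] central_def)
  moreover have "emb (of_nat k * z ^ (k - 1)) = real k *\<^sub>R emb (z ^ (k - 1))"
    using emb.scaleR [of "real k" "z ^ (k - 1)"] by (simp add: scaleR_conv_of_real)
  ultimately show ?thesis
    by (simp add: G_def X_def blinfun_compose.scaleR_left blinfun_compose.scaleR_right
        blinfun_compose.diff_left blinfun_compose.diff_right algebra_simps)
qed

lemma cintegrable_G: "cintegrable (G k)"
  by (rule cintegrable_cderiv [OF cderiv_G])

lemma central_G: "z \<in> resolvent_set \<Longrightarrow> central (G k z)"
  unfolding G_def by (intro central_compose central_emb central_R)

lemma central_V: "central (V k)"
  unfolding V_def by (intro central_cint cintegrable_G central_G)

lemma cint_X:
  shows "cintegrable (X (Suc k))" and "cint (X (Suc k)) = (real (Suc k) / 2) *\<^sub>R V k"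
proof -
  let ?H = "\<lambda>z. real (Suc k) *\<^sub>R G k z - 2 *\<^sub>R X (Suc k) z"
  have H: "cintegrable ?H" "cint ?H = 0"
    using cint_closed [OF cderiv_G [where k = "Suc k"]] by simp_all
  let ?L = "\<lambda>A :: 'v \<Rightarrow>\<^sub>L 'v. (real (Suc k) / 2) *\<^sub>R A" and ?L' = "\<lambda>A :: 'v \<Rightarrow>\<^sub>L 'v. (1 / 2) *\<^sub>R A"
  have L: "bounded_linear ?L" "bounded_linear ?L'"
    by (rule bounded_linear_scaleR_right)+
  note L = L(1) [THEN cint_linear (1)] L(1) [THEN cint_linear (2)]
    L(2) [THEN cint_linear (1)] L(2) [THEN cint_linear (2)]
  \<comment> \<open>Solving the derivative formula for \<open>X\<close> also yields its
    integrability, from that of \<open>G\<close> and of the exact derivative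
    \<open>?H\<close>.\<close>
  have eq: "X (Suc k) = (\<lambda>z. ?L (G k z) - ?L' (?H z))"
    by (simp add: fun_eq_iff scaleR_diff_right)
  have G: "cintegrable (\<lambda>z. ?L (G k z))" "cint (\<lambda>z. ?L (G k z)) = ?L (V k)"
    unfolding V_def
    by (rule L(1), rule blinfun_compose.scaleR_right [symmetric], rule cintegrable_G)
      (rule L(2), rule blinfun_compose.scaleR_right [symmetric], rule cintegrable_G)
  have H': "cintegrable (\<lambda>z. ?L' (?H z))" "cint (\<lambda>z. ?L' (?H z)) = ?L' (cint ?H)"
    by (rule L(3), rule blinfun_compose.scaleR_right [symmetric], rule H)
      (rule L(4), rule blinfun_compose.scaleR_right [symmetric], rule H)
  show "cintegrable (X (Suc k))"
    by (subst eq) (rule cint_diff (1) [OF G(1) H'(1)])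
  show "cint (X (Suc k)) = (real (Suc k) / 2) *\<^sub>R V k"
    by (subst eq) (simp only: cint_diff (2) [OF G(1) H'(1)] G(2) H'(2) H(2), simp)
qed

lemma cint_power: "cint (\<lambda>z. emb (z ^ k)) = 0"
proof (rule cint_closed (2))
  fix z :: complex
  have "((\<lambda>z. z ^ Suc k / of_nat (Suc k)) has_field_derivative z ^ k) (at z)"
    by (rule derivative_eq_intros refl | simp del: of_nat_Suc)+
  then show "cderiv (\<lambda>z. emb (z ^ Suc k / of_nat (Suc k))) (emb (z ^ k)) z"
    by (rule cderiv_emb)
qed

lemma V_recurrence: "V (Suc (Suc k)) = 2 *\<^sub>R (S o\<^sub>L V (Suc k)) - (N o\<^sub>L V k)"
proof -
  let ?L1 = "\<lambda>A. 2 *\<^sub>R (S o\<^sub>L A)" and ?L2 = "\<lambda>A. N o\<^sub>L A"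
  have L: "bounded_linear ?L1" "bounded_linear ?L2"
    by (intro bounded_linear_const_scaleR blinfun_compose.bounded_linear_right)+
  have comm: "S o\<^sub>L (I o\<^sub>L A) = I o\<^sub>L (S o\<^sub>L A)" "N o\<^sub>L (I o\<^sub>L A) = I o\<^sub>L (N o\<^sub>L A)" for A
    by (simp_all add: blinfun_compose_assoc [symmetric] IS IN)
  have 1: "cintegrable (\<lambda>z. ?L1 (G (Suc k) z))" "cint (\<lambda>z. ?L1 (G (Suc k) z)) = ?L1 (V (Suc k))"
    unfolding V_def
    by (rule cint_linear (1) [OF L(1) _ cintegrable_G], simp add: comm blinfun_compose.scaleR_right)
      (rule cint_linear (2) [OF L(1) _ cintegrable_G], simp add: comm blinfun_compose.scaleR_right)
  have 2: "cintegrable (\<lambda>z. ?L2 (G k z))" "cint (\<lambda>z. ?L2 (G k z)) = ?L2 (V k)"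
    unfolding V_def
    by (rule cint_linear (1) [OF L(2) _ cintegrable_G], simp add: comm)
      (rule cint_linear (2) [OF L(2) _ cintegrable_G], simp add: comm)
  have 3: "cintegrable (\<lambda>z. ?L1 (G (Suc k) z) - ?L2 (G k z))"
    "cint (\<lambda>z. ?L1 (G (Suc k) z) - ?L2 (G k z)) = ?L1 (V (Suc k)) - ?L2 (V k)"
    using cint_diff [OF 1(1) 2(1)] by (simp_all add: 1 2)
  have "G (Suc (Suc k)) z - (?L1 (G (Suc k) z) - ?L2 (G k z)) = emb (z ^ k)"
    if z: "z \<in> resolvent_set" for z
  proof -
    have SE: "S o\<^sub>L (emb a o\<^sub>L A) = emb a o\<^sub>L (S o\<^sub>L A)" "N o\<^sub>L (emb a o\<^sub>L A) = emb a o\<^sub>L (N o\<^sub>L A)" for a A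
      by (simp_all add: blinfun_compose_assoc [symmetric] central_emb_commute central_S central_N)
    have "G (Suc (Suc k)) z - (?L1 (G (Suc k) z) - ?L2 (G k z)) = emb (z ^ k) o\<^sub>L (Q z o\<^sub>L R z)"
      by (simp add: G_def Q_def power_Suc2 emb_mult SE blinfun_compose_simps del: power_Suc)
    then show ?thesis
      using Q_R [OF z] by simp
  qed
  then have "cint (\<lambda>z. G (Suc (Suc k)) z - (?L1 (G (Suc k) z) - ?L2 (G k z))) = cint (\<lambda>z. emb (z ^ k))"
    by (rule cint_cong (1))
  also have "\<dots> = 0"
    by (rule cint_power)
  finally show ?thesis
    using cint_diff (2) [OF cintegrable_G 3(1)] 3(2) by (simp add: V_def)
qed

text \<open>The resolvent equation for \<open>R z - R w\<close> evaluates the Cauchy transform of \<open>R\<close> at \<open>w\<close> in terms of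
  the first two moments.\<close>

definition W :: "complex \<Rightarrow> 'v \<Rightarrow>\<^sub>L 'v" where
  "W w = emb (of_real (2 * pi) * \<i>) + ((2 *\<^sub>R S - emb w) o\<^sub>L V 0) - V 1"

lemma cauchy_transform_R:
  assumes \<phi>: "bounded_linear \<phi>" and w: "w \<in> D" "w \<in> resolvent_set"
  shows "(\<Sum>\<gamma>\<in>\<Gamma>. contour_integral \<gamma> (\<lambda>z. cfun \<phi> (R z) / (z - w))) = cfun \<phi> (W w o\<^sub>L R w)"
proof -
  interpret cfun: bounded_linear "cfun \<phi>"
    by (rule bounded_linear_cfun [OF \<phi>])
  \<comment> \<open>The splitting \<open>2 S - (z + w) = (2 S - w) - z\<close> produces a zeroth and
    a first moment.\<close>
  let ?L0 = "\<lambda>A. (2 *\<^sub>R S - emb w) o\<^sub>L (A o\<^sub>L R w)" and ?L1 = "\<lambda>A. A o\<^sub>L R w"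
  let ?H = "\<lambda>z. ?L0 (G 0 z) - ?L1 (G 1 z)"
  have L: "bounded_linear ?L0" "bounded_linear ?L1"
    by (rule bounded_linear_compose [OF blinfun_compose.bounded_linear_right
          blinfun_compose.bounded_linear_left], rule blinfun_compose.bounded_linear_left)
  have "central (2 *\<^sub>R S - emb w)"
    by (intro central_diff central_scaleR central_S central_emb)
  then have "(2 *\<^sub>R S - emb w) o\<^sub>L I = I o\<^sub>L (2 *\<^sub>R S - emb w)"
    by (simp add: central_def)
  then have L0_I: "?L0 (I o\<^sub>L A) = I o\<^sub>L ?L0 A" for A
    by (simp add: blinfun_compose_assoc [symmetric])
  have L1_I: "?L1 (I o\<^sub>L A) = I o\<^sub>L ?L1 A" for A
    by (rule blinfun_compose_assoc)
  \<comment> \<open>The equation is integrated curve by curve. The individual winding numbers are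
    unknown; only their sum is 1.\<close>
  have int: "contour_integral \<gamma> (\<lambda>z. cfun \<phi> (R z) / (z - w)) =
      cfun \<phi> (R w) * (of_real (2 * pi) * \<i> * winding_number \<gamma> w) +
      cfun \<phi> (?L0 (vint \<gamma> (G 0)) - ?L1 (vint \<gamma> (G 1)))" if \<gamma>: "\<gamma> \<in> \<Gamma>" for \<gamma>
  proof -
    have G: "vintegrable \<gamma> (G k)" for k
      using cintegrable_G \<gamma> by (simp add: cintegrable_def)
    note L0 = vint_linear [OF L(1) L0_I G [of 0]]
    note L1 = vint_linear [OF L(2) L1_I G [of 1]]
    have "vint \<gamma> ?H = ?L0 (vint \<gamma> (G 0)) - ?L1 (vint \<gamma> (G 1))"
      by (simp only: vint_diff [OF L0(1) L1(1)] L0(2) L1(2))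
    then have H: "((\<lambda>z. cfun \<phi> (?H z)) has_contour_integral
        cfun \<phi> (?L0 (vint \<gamma> (G 0)) - ?L1 (vint \<gamma> (G 1)))) \<gamma>"
      using cfun_vint [OF \<phi> vintegrable_diff [OF L0(1) L1(1)]] by simp
    have "w \<notin> path_image \<gamma>"
      using disjoint_D [OF \<gamma>] w by blast
    from has_contour_integral_add [OF has_contour_integral_lmul [where c = "cfun \<phi> (R w)",
          OF has_contour_integral_winding_number [OF valid_cycle [OF \<gamma>] this]] H]
    have "((\<lambda>z. cfun \<phi> (R z) / (z - w)) has_contour_integral
        cfun \<phi> (R w) * (of_real (2 * pi) * \<i> * winding_number \<gamma> w) +
        cfun \<phi> (?L0 (vint \<gamma> (G 0)) - ?L1 (vint \<gamma> (G 1)))) \<gamma>"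
    proof (rule has_contour_integral_eq)
      fix z assume z: "z \<in> path_image \<gamma>"
      then have zr: "z \<in> resolvent_set" and "z \<noteq> w"
        using path_image_subset [OF \<gamma>] \<open>w \<notin> path_image \<gamma>\<close> by auto
      have "R z o\<^sub>L (2 *\<^sub>R S - emb (z + w)) = (2 *\<^sub>R S - emb (z + w)) o\<^sub>L R z"
        by (intro central_R_commute [OF zr, symmetric] central_diff central_scaleR central_S central_emb)
      then have H_eq: "R z o\<^sub>L ((2 *\<^sub>R S - emb (z + w)) o\<^sub>L R w) = ?H z"
        by (simp add: blinfun_compose_assoc [symmetric] G_def)
          (simp add: emb.add blinfun_compose_simps)
      have "R z - R w = act (z - w) (?H z)"
        by (simp only: R_diff [OF zr w(2)] H_eq)
      then have "R z = R w + act (z - w) (?H z)"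
        by (simp only: diff_eq_eq add.commute)
      then have "cfun \<phi> (R z) = cfun \<phi> (R w) + (z - w) * cfun \<phi> (?H z)"
        using cfun.add [of "R w" "act (z - w) (?H z)"] cfun_act [OF \<phi>, of "z - w" "?H z"] by simp
      then show "cfun \<phi> (R w) * (1 / (z - w)) + cfun \<phi> (?H z) = cfun \<phi> (R z) / (z - w)"
        using \<open>z \<noteq> w\<close> by (simp add: field_simps)
    qed
    then show ?thesis
      by (rule contour_integral_unique)
  qed
  have "(\<Sum>\<gamma>\<in>\<Gamma>. contour_integral \<gamma> (\<lambda>z. cfun \<phi> (R z) / (z - w))) =
      (\<Sum>\<gamma>\<in>\<Gamma>. (of_real (2 * pi) * \<i> * cfun \<phi> (R w)) * winding_number \<gamma> w) +
      (\<Sum>\<gamma>\<in>\<Gamma>. cfun \<phi> (?L0 (vint \<gamma> (G 0)) - ?L1 (vint \<gamma> (G 1))))"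
    by (simp add: int sum.distrib mult_ac)
  also have "\<dots> = cfun \<phi> (act (of_real (2 * pi) * \<i>) (R w)) + cfun \<phi> (?L0 (V 0) - ?L1 (V 1))"
    by (simp only: cfun_act [OF \<phi>] sum_distrib_left [symmetric] winding_D [OF w(1)]
        cfun.sum [symmetric] sum_subtractf V_def cint_def blinfun_compose.sum_left
        blinfun_compose.sum_right mult_1_right)
  also have "\<dots> = cfun \<phi> (act (of_real (2 * pi) * \<i>) (R w) + (?L0 (V 0) - ?L1 (V 1)))"
    by (rule cfun.add [symmetric])
  also have "act (of_real (2 * pi) * \<i>) (R w) + (?L0 (V 0) - ?L1 (V 1)) = W w o\<^sub>L R w"
    by (simp add: W_def act_eq blinfun_compose.add_left blinfun_compose.diff_left blinfun_compose_assoc)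
  finally show ?thesis .
qed

lemma holomorphic_W_R:
  assumes \<phi>: "bounded_linear \<phi>"
  shows "(\<lambda>w. cfun \<phi> (W w o\<^sub>L R w)) holomorphic_on resolvent_set"
proof -
  have W: "cderiv W (- V 0) w" for w
  proof -
    let ?c = "emb (of_real (2 * pi) * \<i>) + (2 *\<^sub>R S o\<^sub>L V 0) - V 1"
    have "W = (\<lambda>w. ?c - (emb w o\<^sub>L V 0))"
      by (simp add: fun_eq_iff W_def blinfun_compose.diff_left)
    moreover have "bounded_linear (\<lambda>w. emb w o\<^sub>L V 0)"
      using act.bounded_linear_left [of "V 0"] by (simp add: act_eq)
    then have "((\<lambda>w. ?c - (emb w o\<^sub>L V 0)) has_derivative (\<lambda>h. 0 - (emb h o\<^sub>L V 0))) (at w)"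
      by (intro has_derivative_diff has_derivative_const bounded_linear_imp_has_derivative)
    ultimately show ?thesis
      by (simp add: cderiv_def act_eq blinfun_compose.minus_right)
  qed
  have "central (W w)" for w
    unfolding W_def
    by (intro central_add central_diff central_compose central_scaleR central_emb central_S central_V)
  then have "\<exists>D. cderiv (\<lambda>w. W w o\<^sub>L R w) D w" if "w \<in> resolvent_set" for w
    using cderiv_compose [OF W cderiv_R [OF that]] by (auto simp: central_def)
  then show ?thesis
    unfolding holomorphic_on_open [OF open_resolvent_set] using cderiv_cfun [OF \<phi>] by blast
qed

text \<open>\<open>W\<close> is affine and \<open>R\<close> decays quadratically. Taking
  \<open>norm w \<ge> 1\<close> absorbs the constant part of \<open>W\<close> into the linear
  one.\<close>

lemma W_R_tendsto_0:
  assumes \<phi>: "bounded_linear \<phi>"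
  shows "((\<lambda>w. cfun \<phi> (W w o\<^sub>L R w)) \<longlongrightarrow> 0) at_infinity"
proof -
  obtain B where B: "B > 0" "\<And>A. norm (cfun \<phi> A) \<le> norm A * B"
    using bounded_linear.pos_bounded [OF bounded_linear_cfun [OF \<phi>]] by blast
  obtain M where M: "M > 0" "\<And>z. norm (emb z) \<le> norm z * M"
    using emb.pos_bounded by blast
  obtain C r where C: "r > 0" "\<And>w. r \<le> norm w \<Longrightarrow> w \<in> resolvent_set \<and> norm (R w) \<le> C / (norm w)\<^sup>2"
    using R_decay by blast
  define a where "a = norm (emb (of_real (2 * pi) * \<i>) + (2 *\<^sub>R S o\<^sub>L V 0) - V 1)"
  define K where "K = (a + M * norm (V 0)) * C * B"
  have le: "norm (cfun \<phi> (W w o\<^sub>L R w)) \<le> norm (K / norm w)" if w: "max 1 r \<le> norm w" for w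
  proof -
    have w0: "norm w > 0" using w by linarith
    have "W w = (emb (of_real (2 * pi) * \<i>) + (2 *\<^sub>R S o\<^sub>L V 0) - V 1) - (emb w o\<^sub>L V 0)"
      by (simp add: W_def blinfun_compose.diff_left)
    then have "norm (W w) \<le> a + norm (emb w o\<^sub>L V 0)"
      unfolding a_def by (metis norm_triangle_ineq4)
    also have "norm (emb w o\<^sub>L V 0) \<le> (norm w * M) * norm (V 0)"
      by (intro order_trans [OF norm_blinfun_compose] mult_right_mono M norm_ge_zero)
    also have "a + \<dots> \<le> norm w * (a + M * norm (V 0))"
      using w mult_right_mono [of 1 "norm w" a] by (simp add: a_def algebra_simps)
    finally have nW: "norm (W w) \<le> norm w * (a + M * norm (V 0))" by simp
    have nR: "norm (R w) \<le> C / (norm w)\<^sup>2"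
      using C(2) w by simp
    have "norm (cfun \<phi> (W w o\<^sub>L R w)) \<le> (norm (W w) * norm (R w)) * B"
      using B by (meson order_trans norm_blinfun_compose mult_right_mono less_imp_le)
    also have "\<dots> \<le> ((norm w * (a + M * norm (V 0))) * (C / (norm w)\<^sup>2)) * B"
      using B(1) M(1) by (intro mult_right_mono mult_mono nW nR) (auto simp: a_def)
    also have "\<dots> = K / norm w"
      using w0 by (simp add: K_def power2_eq_square)
    also have "\<dots> \<le> norm (K / norm w)"
      unfolding real_norm_def by (rule abs_ge_self)
    finally show ?thesis .
  qed
  have "((\<lambda>w::complex. K / norm w) \<longlongrightarrow> 0) at_infinity"
    by (intro tendsto_divide_0 [OF tendsto_const] filterlim_at_top_imp_at_infinity filterlim_norm_at_top)
  moreover have "\<forall>\<^sub>F w in at_infinity. norm (cfun \<phi> (W w o\<^sub>L R w)) \<le> norm (K / norm w)"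
    unfolding eventually_at_infinity using le by blast
  ultimately show ?thesis
    by (metis (no_types) Lim_null_comparison tendsto_norm_zero)
qed

text \<open>By \<open>cauchy_transform_R\<close>, the function \<open>w \<mapsto> W w o\<^sub>L R w\<close> extends holomorphically across the
  spectrum; it vanishes at infinity, so it is zero by Liouville's theorem.\<close>

lemma W_eq_0:
  assumes w: "w \<in> resolvent_set"
  shows "W w = 0"
proof -
  have "W w o\<^sub>L R w = 0"
  proof (rule cfun_eqI)
    fix \<phi> :: "('v \<Rightarrow>\<^sub>L 'v) \<Rightarrow> real" assume \<phi>: "bounded_linear \<phi>"
    interpret cfun: bounded_linear "cfun \<phi>"
      by (rule bounded_linear_cfun [OF \<phi>])
    let ?C = "\<lambda>w. \<Sum>\<gamma>\<in>\<Gamma>. contour_integral \<gamma> (\<lambda>z. cfun \<phi> (R z) / (z - w))"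
    \<comment> \<open>The branches agree on \<open>D \<inter> resolvent_set\<close> by
      \<open>cauchy_transform_R\<close>, so \<open>u\<close> is holomorphic on two open sets that
      cover the plane.\<close>
    define u where "u w = (if w \<in> D then ?C w else cfun \<phi> (W w o\<^sub>L R w))" for w
    have u: "u w = cfun \<phi> (W w o\<^sub>L R w)" if "w \<in> resolvent_set" for w
      using cauchy_transform_R [OF \<phi> _ that] by (simp add: u_def)
    have "(\<lambda>z. cfun \<phi> (R z)) holomorphic_on resolvent_set"
      unfolding holomorphic_on_open [OF open_resolvent_set]
      using cderiv_cfun [OF \<phi> cderiv_R] by blast
    then have "(\<lambda>w. contour_integral \<gamma> (\<lambda>z. cfun \<phi> (R z) / (z - w))) holomorphic_on D"
      if "\<gamma> \<in> \<Gamma>" for \<gamma>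
      using disjoint_D [OF that]
      by (intro holomorphic_on_subset [OF cauchy_type_integral_holomorphic
            [OF open_resolvent_set _ valid_cycle [OF that] path_image_subset [OF that]
              closed_cycle [OF that]]]) auto
    then have "?C holomorphic_on D"
      by (intro holomorphic_on_sum)
    then have "u holomorphic_on D"
      by (rule holomorphic_transform) (simp add: u_def)
    moreover have "u holomorphic_on resolvent_set"
      by (rule holomorphic_transform [OF holomorphic_W_R [OF \<phi>]]) (simp add: u)
    ultimately have "u holomorphic_on (D \<union> resolvent_set)"
      by (intro holomorphic_on_Un open_D open_resolvent_set)
    moreover have "D \<union> resolvent_set = UNIV"
      using compl_D by blast
    ultimately have "u holomorphic_on UNIV" by simp
    moreover have "(u \<longlongrightarrow> 0) at_infinity"
    proof (rule Lim_transform_eventually [OF W_R_tendsto_0 [OF \<phi>]])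
      obtain b where "\<And>x. x \<in> D \<Longrightarrow> norm x \<le> b"
        using bounded_D by (auto simp: bounded_iff)
      then have "cfun \<phi> (W w o\<^sub>L R w) = u w" if "b + 1 \<le> norm w" for w
        using that by (force simp: u_def)
      then show "\<forall>\<^sub>F w in at_infinity. cfun \<phi> (W w o\<^sub>L R w) = u w"
        unfolding eventually_at_infinity by blast
    qed
    ultimately have "u w = 0"
      by (rule Liouville_weak_0)
    then show "cfun \<phi> (W w o\<^sub>L R w) = cfun \<phi> 0"
      using u [OF w] by (simp add: cfun.zero)
  qed
  then have "(W w o\<^sub>L R w) o\<^sub>L Q w = 0"
    by simp
  then show ?thesis
    by (simp add: blinfun_compose_assoc R_Q [OF w])
qed

text \<open>\<open>W\<close> is affine in \<open>w\<close> with linear coefficient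
  \<open>- V 0\<close>; two zeros at distance one isolate \<open>V 0\<close>, and the constant term
  then yields \<open>V 1\<close>.\<close>

lemma V_0: "V 0 = 0" and V_1: "V 1 = (2 * pi) *\<^sub>R I"
proof -
  obtain C r where r: "r > 0" "\<And>w. r \<le> norm w \<Longrightarrow> w \<in> resolvent_set \<and> norm (R w) \<le> C / (norm w)\<^sup>2"
    using R_decay by blast
  then have "W (of_real r) = 0" "W (of_real (r + 1)) = 0"
    by (intro W_eq_0; simp)+
  then have "W (of_real r) - W (of_real (r + 1)) = 0"
    by simp
  moreover have "W (of_real r) - W (of_real (r + 1)) = V 0"
    by (simp add: W_def emb.add blinfun_compose_simps)
  ultimately show "V 0 = 0" by simp
  then have "V 1 = emb (of_real (2 * pi) * \<i>)"
    using \<open>W (of_real r) = 0\<close> by (simp add: W_def)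
  then show "V 1 = (2 * pi) *\<^sub>R I"
    by (simp add: emb_def)
qed

end

section \<open>Quaternionic operators\<close>

lemma lmult_distrib: "lmult (a + b) x = lmult a x + lmult b x" "lmult (a - b) x = lmult a x - lmult b x"
  "lmult (- a) x = - lmult a x"
  by (cases x; simp add: algebra_simps)+

lemma lmult_of_real: "lmult (of_real r) x = r *\<^sub>R x"
  by (cases x) (simp add: of_real_def)

lemma lmult_scaleR: "lmult (r *\<^sub>R a) x = r *\<^sub>R lmult a x"
  by (cases x) (simp add: algebra_simps)

lemma lmul_op_mult: "lmul_op (a * b) = lmul_op a o\<^sub>L lmul_op b"
  by (rule blinfun_eqI) (simp add: lmul_op.rep_eq lmult_mult)

lemma lmul_op_add: "lmul_op (a + b) = lmul_op a + lmul_op b"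
  and lmul_op_minus: "lmul_op (- a) = - lmul_op a"
  by (rule blinfun_eqI, simp add: lmul_op.rep_eq lmult_distrib blinfun.bilinear_simps)+

lemma lmul_op_of_real: "lmul_op (of_real r) = r *\<^sub>R id_blinfun"
  by (rule blinfun_eqI) (simp add: lmul_op.rep_eq lmult_of_real blinfun.bilinear_simps)

text \<open>The source of all commutation with \<open>J\<close>: \<open>T\<^sub>0\<close> and
  \<open>N\<close> both have the form \<open>real_op A\<close>.\<close>

lemma real_op_lmul_op: "real_op A o\<^sub>L lmul_op a = lmul_op a o\<^sub>L real_op A"
  by (rule blinfun_eqI) (auto simp: lmul_op.rep_eq real_op.rep_eq blinfun.bilinear_simps)

lemma BX_iff: "A \<in> BX \<longleftrightarrow> (\<forall>x a. blinfun_apply A (rmult x a) = rmult (blinfun_apply A x) a)"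
  by (simp add: BX_def)

lemma rmult_distrib: "rmult (x + y) a = rmult x a + rmult y a" "rmult (x - y) a = rmult x a - rmult y a"
  "rmult (r *\<^sub>R x) a = r *\<^sub>R rmult x a"
  by (cases x; cases y; simp add: algebra_simps)+

lemma BX_add: "A \<in> BX \<Longrightarrow> B \<in> BX \<Longrightarrow> A + B \<in> BX"
  and BX_diff: "A \<in> BX \<Longrightarrow> B \<in> BX \<Longrightarrow> A - B \<in> BX"
  and BX_compose: "A \<in> BX \<Longrightarrow> B \<in> BX \<Longrightarrow> A o\<^sub>L B \<in> BX"
  by (simp_all add: BX_iff rmult_distrib blinfun.bilinear_simps del: split_paired_All)

lemma lmul_op_BX: "lmul_op a \<in> BX"
  by (simp add: BX_iff lmul_op.rep_eq lmult_rmult del: split_paired_All)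

lemma real_op_BX: "real_op A \<in> BX"
  by (auto simp: BX_iff real_op.rep_eq blinfun.bilinear_simps)

text \<open>Apply \<open>A\<close> to both sides and cancel. This is how the inverses below become
  admissible for \<open>op_inv\<close>.\<close>

lemma inverse_ops_BX:
  assumes "A \<in> BX" "inverse_ops A B"
  shows "B \<in> BX"
  unfolding BX_iff
proof (intro allI)
  fix x a
  have BA: "blinfun_apply B (blinfun_apply A y) = y" and AB: "blinfun_apply A (blinfun_apply B y) = y" for y
    using assms(2) by (metis inverse_ops_def blinfun_apply_blinfun_compose id_blinfun.rep_eq)+
  have "blinfun_apply A (rmult (blinfun_apply B x) a) = rmult x a"
    using assms(1) AB by (simp add: BX_iff del: split_paired_All)
  then show "blinfun_apply B (rmult x a) = rmult (blinfun_apply B x) a"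
    using BA by metis
qed

text \<open>Quaternionic conjugation, written so that the sum with \<open>s\<close> is visibly
  real.\<close>

definition quat_cnj :: "quat \<Rightarrow> quat" where
  "quat_cnj s = of_real (2 * qre s) - s"

lemma qre_of_real [simp]: "qre (of_real r) = r" "qim1 (of_real r) = 0" "qim2 (of_real r) = 0" "qim3 (of_real r) = 0"
  by (simp_all add: of_real_def)

lemma quat_cnj_mult: "s * quat_cnj s = of_real ((norm s)\<^sup>2)" "quat_cnj s * s = of_real ((norm s)\<^sup>2)"
  by (simp_all add: quat_eq_iff quat_cnj_def norm_quat_def power2_eq_square algebra_simps
      del: of_real_mult of_real_power)

lemma quat_units_square: "e1 * e1 = - 1" "e2 * e2 = - 1" "e3 * e3 = - 1"
  by (simp_all add: quat_eq_iff e1_def e2_def e3_def)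

text \<open>The components of an operator with inverse \<open>B\<close> are recovered from conjugation by the units:
  \<open>A\<^sub>0 = (A - e1 A e1 - e2 A e2 - e3 A e3) / 4\<close>. The same average of \<open>B\<close> yields the inverse
  \<open>2 B B\<^sub>0 - B\<^sup>2\<close> of the squared modulus \<open>A A'\<close>.\<close>

lemma modulus_invertible:
  fixes A A' A0 B D E1 E2 E3 :: "'v::real_normed_vector \<Rightarrow>\<^sub>L 'v"
  assumes B: "inverse_ops A B" and D: "A o\<^sub>L A' = D" "A' o\<^sub>L A = D" and sum: "A + A' = 2 *\<^sub>R A0"
    and re: "A' - (E1 o\<^sub>L (A' o\<^sub>L E1)) - (E2 o\<^sub>L (A' o\<^sub>L E2)) - (E3 o\<^sub>L (A' o\<^sub>L E3)) = 4 *\<^sub>R A0"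
    and E: "D o\<^sub>L E1 = E1 o\<^sub>L D" "D o\<^sub>L E2 = E2 o\<^sub>L D" "D o\<^sub>L E3 = E3 o\<^sub>L D"
  obtains D' where "inverse_ops D D'"
proof -
  define B0 where
    "B0 = (1/4) *\<^sub>R (B - (E1 o\<^sub>L (B o\<^sub>L E1)) - (E2 o\<^sub>L (B o\<^sub>L E2)) - (E3 o\<^sub>L (B o\<^sub>L E3)))"
  have AB: "A o\<^sub>L B = id_blinfun" "B o\<^sub>L A = id_blinfun"
    using B by (auto simp: inverse_ops_def)
  have "D o\<^sub>L A = A o\<^sub>L D"
    using D by (metis blinfun_compose_assoc)
  then have DB: "D o\<^sub>L B = B o\<^sub>L D"
    by (rule inverse_ops_commute [OF B])
  have DB': "D o\<^sub>L B = A'"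
    by (simp add: D(2) [symmetric] blinfun_compose_assoc AB)
  have E': "D o\<^sub>L (E1 o\<^sub>L X) = E1 o\<^sub>L (D o\<^sub>L X)" "D o\<^sub>L (E2 o\<^sub>L X) = E2 o\<^sub>L (D o\<^sub>L X)"
    "D o\<^sub>L (E3 o\<^sub>L X) = E3 o\<^sub>L (D o\<^sub>L X)" for X
    by (simp_all add: blinfun_compose_assoc [symmetric] E)
  have DBX: "D o\<^sub>L (B o\<^sub>L X) = A' o\<^sub>L X" for X
    by (simp add: blinfun_compose_assoc [symmetric] DB')
  have DB0: "D o\<^sub>L B0 = A0"
    using re by (simp add: B0_def blinfun_compose.scaleR_right blinfun_compose.diff_right DB' DBX E')
  have "D o\<^sub>L (E o\<^sub>L (B o\<^sub>L E)) = (E o\<^sub>L (B o\<^sub>L E)) o\<^sub>L D" if "D o\<^sub>L E = E o\<^sub>L D" for E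
    using that DB by (simp add: compose_commute)
  then have DB0': "D o\<^sub>L B0 = B0 o\<^sub>L D"
    using DB E by (simp add: B0_def blinfun_compose.scaleR_right blinfun_compose.scaleR_left
        blinfun_compose.diff_right blinfun_compose.diff_left)
  \<comment> \<open>\<open>2 B\<^sub>0 - B\<close> is to \<open>B\<close> what
    \<open>A' = 2 A\<^sub>0 - A\<close> is to \<open>A\<close>, so the candidate is the squared
    modulus of \<open>B\<close>.\<close>
  define D' where "D' = 2 *\<^sub>R (B o\<^sub>L B0) - (B o\<^sub>L B)"
  have "D o\<^sub>L (B o\<^sub>L B0) = B o\<^sub>L A0" "D o\<^sub>L (B o\<^sub>L B) = B o\<^sub>L A'"
    using DB DB0 DB' by (metis blinfun_compose_assoc)+
  then have "D o\<^sub>L D' = B o\<^sub>L (2 *\<^sub>R A0 - A')"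
    by (simp add: D'_def blinfun_compose.scaleR_right blinfun_compose.diff_right)
  also have "\<dots> = id_blinfun"
    using AB by (simp add: sum [symmetric])
  finally have 1: "D o\<^sub>L D' = id_blinfun" .
  have "D' o\<^sub>L D = D o\<^sub>L D'"
    using compose_commute [OF DB [symmetric] DB0' [symmetric]]
      compose_commute [OF DB [symmetric] DB [symmetric]]
    by (simp add: D'_def blinfun_compose.scaleR_right blinfun_compose.scaleR_left
        blinfun_compose.diff_right blinfun_compose.diff_left)
  with 1 that show ?thesis
    by (simp add: inverse_ops_def)
qed

section \<open>Operators with commuting components\<close>

locale BC_operator =
  fixes T :: "'a::banach qop" and A0 A1 A2 A3 :: "'a \<Rightarrow>\<^sub>L 'a"
  assumes T_eq: "T = qop A0 A1 A2 A3"
    and comm: "\<forall>A\<in>{A0, A1, A2, A3}. \<forall>B\<in>{A0, A1, A2, A3}. A o\<^sub>L B = B o\<^sub>L A"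
begin

abbreviation "T' \<equiv> op_conj T"
abbreviation "T0 \<equiv> op_re T"
abbreviation "N \<equiv> T o\<^sub>L op_conj T"

lemma T'_eq: "T' = real_op A0 - real_op A1 \<cdot>\<^sub>r e1 - real_op A2 \<cdot>\<^sub>r e2 - real_op A3 \<cdot>\<^sub>r e3"
  by (simp add: T_eq op_conj_qop)

lemma T0_eq: "T0 = real_op A0"
  by (simp add: T_eq op_re_qop)

lemma T_apply: "blinfun_apply T (x0, x1, x2, x3) =
  (A0 x0 - A1 x1 - A2 x2 - A3 x3, A0 x1 + A1 x0 + A2 x3 - A3 x2,
   A0 x2 - A1 x3 + A2 x0 + A3 x1, A0 x3 + A1 x2 - A2 x1 + A3 x0)"
  by (simp add: T_eq qop_def op_rscale_def lmul_op.rep_eq real_op.rep_eq e1_def e2_def e3_def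
      blinfun.bilinear_simps)

lemma T'_apply: "blinfun_apply T' (x0, x1, x2, x3) =
  (A0 x0 + A1 x1 + A2 x2 + A3 x3, A0 x1 - A1 x0 - A2 x3 + A3 x2,
   A0 x2 + A1 x3 - A2 x0 - A3 x1, A0 x3 - A1 x2 + A2 x1 - A3 x0)"
  by (simp add: T'_eq op_rscale_def lmul_op.rep_eq real_op.rep_eq e1_def e2_def e3_def
      blinfun.bilinear_simps)

text \<open>Oriented so that rewriting moves the component of smaller index outwards, which brings
  the coordinate computations to a normal form.\<close>

lemma comm_apply: "A1 (A0 x) = A0 (A1 x)" "A2 (A0 x) = A0 (A2 x)" "A3 (A0 x) = A0 (A3 x)"
  "A2 (A1 x) = A1 (A2 x)" "A3 (A1 x) = A1 (A3 x)" "A3 (A2 x) = A2 (A3 x)"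
proof -
  have *: "A (B x) = B (A x)" if "A \<in> {A0, A1, A2, A3}" "B \<in> {A0, A1, A2, A3}" for A B
  proof -
    have "A o\<^sub>L B = B o\<^sub>L A"
      using comm that by blast
    then show ?thesis
      by (metis blinfun_apply_blinfun_compose)
  qed
  show "A1 (A0 x) = A0 (A1 x)" "A2 (A0 x) = A0 (A2 x)" "A3 (A0 x) = A0 (A3 x)"
    "A2 (A1 x) = A1 (A2 x)" "A3 (A1 x) = A1 (A3 x)" "A3 (A2 x) = A2 (A3 x)"
    by (rule *; simp)+
qed

lemma T_add_T': "T + T' = 2 *\<^sub>R T0"
  by (simp add: T'_eq T0_eq) (simp add: T_eq qop_def scaleR_2)

text \<open>The cross terms cancel as for the squared modulus of a quaternion, because the
  components commute. In particular \<open>N\<close> acts componentwise.\<close>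

lemma N_eq: "N = real_op ((A0 o\<^sub>L A0) + (A1 o\<^sub>L A1) + (A2 o\<^sub>L A2) + (A3 o\<^sub>L A3))"
  by (rule blinfun_eqI)
    (auto simp: T_apply T'_apply real_op.rep_eq blinfun.bilinear_simps comm_apply)

lemma T'_T: "T' o\<^sub>L T = N"
  unfolding N_eq
  by (rule blinfun_eqI)
    (auto simp: T_apply T'_apply real_op.rep_eq blinfun.bilinear_simps comm_apply)

lemma T0_T: "T0 o\<^sub>L T = T o\<^sub>L T0"
  unfolding T0_eq
  by (rule blinfun_eqI) (auto simp: T_apply real_op.rep_eq blinfun.bilinear_simps comm_apply)

lemma T0_T': "T0 o\<^sub>L T' = T' o\<^sub>L T0"
  unfolding T0_eq
  by (rule blinfun_eqI) (auto simp: T'_apply real_op.rep_eq blinfun.bilinear_simps comm_apply)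

lemma N_T: "N o\<^sub>L T = T o\<^sub>L N"
  by (simp add: blinfun_compose_assoc T'_T)

lemma N_T': "N o\<^sub>L T' = T' o\<^sub>L N"
  by (simp add: blinfun_compose_assoc [symmetric] T'_T)

lemma T0_N: "T0 o\<^sub>L N = N o\<^sub>L T0"
  by (simp add: compose_commute T0_T T0_T')

lemma T0_lmul: "T0 o\<^sub>L lmul_op a = lmul_op a o\<^sub>L T0"
  by (simp add: T0_eq real_op_lmul_op)

lemma N_lmul: "N o\<^sub>L lmul_op a = lmul_op a o\<^sub>L N"
  by (simp add: N_eq real_op_lmul_op)

text \<open>For a single quaternion this is
  \<open>q - e1 q e1 - e2 q e2 - e3 q e3 = 4 Re q\<close>.\<close>

lemma T'_re: "T' - (lmul_op e1 o\<^sub>L (T' o\<^sub>L lmul_op e1)) - (lmul_op e2 o\<^sub>L (T' o\<^sub>L lmul_op e2))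
    - (lmul_op e3 o\<^sub>L (T' o\<^sub>L lmul_op e3)) = 4 *\<^sub>R T0"
proof -
  have "4 *\<^sub>R x = x + x + x + x" for x :: 'a
    using scaleR_left_distrib [of 2 2 x] by (simp add: scaleR_2)
  then show ?thesis
    unfolding T0_eq
    by (intro blinfun_eqI)
      (auto simp: T'_apply lmul_op.rep_eq real_op.rep_eq e1_def e2_def e3_def blinfun.bilinear_simps)
qed

lemma Q_c_BX: "Q_c s T \<in> BX"
proof -
  have "T + T' \<in> BX"
    unfolding T_add_T' T0_eq scaleR_2 by (intro BX_add real_op_BX)
  then have "lmul_op (s\<^sup>2) - (lmul_op s o\<^sub>L (T + T')) \<in> BX"
    by (intro BX_diff BX_compose [OF lmul_op_BX] lmul_op_BX)
  then show ?thesis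
    unfolding Q_c_def op_lscale_def N_eq by (intro BX_add real_op_BX)
qed

text \<open>With \<open>M = 2 T\<^sub>0 - 2 Re s\<close> and \<open>n = \<bar>s\<bar>\<^sup>2 - T T'\<close> one has \<open>T\<^sup>2 - 2 Re s T + \<bar>s\<bar>\<^sup>2 = M T + n\<close>
  and \<open>Q\<^sub>c s T = - (M s + n)\<close>. Hence both the squared modulus of the former and the product of
  the latter with its conjugate are equal to \<open>\<bar>s\<bar>\<^sup>2 M\<^sup>2 + 2 Re s M n + n\<^sup>2\<close>.\<close>

lemma Q_c_invertible:
  assumes s: "s \<in> S_resolvent_set T"
  obtains B where "inverse_ops (Q_c s T) B"
proof -
  define a c where "a = 2 * qre s" and "c = (norm s)\<^sup>2"
  define M n where "M = 2 *\<^sub>R T0 - a *\<^sub>R id_blinfun" and "n = c *\<^sub>R id_blinfun - N"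
  define D where "D = c *\<^sub>R (M o\<^sub>L M) + a *\<^sub>R (M o\<^sub>L n) + (n o\<^sub>L n)"
  define A where "A = (M o\<^sub>L T) + n"
  define A' where "A' = (M o\<^sub>L T') + n"
  let ?\<sigma> = "lmul_op s :: 'a qop" and ?\<sigma>' = "lmul_op (quat_cnj s) :: 'a qop"
  have M_comm: "C o\<^sub>L M = M o\<^sub>L C" if "T0 o\<^sub>L C = C o\<^sub>L T0" for C
    using that by (simp add: M_def blinfun_compose_simps)
  have n_comm: "C o\<^sub>L n = n o\<^sub>L C" if "N o\<^sub>L C = C o\<^sub>L N" for C
    using that by (simp add: n_def blinfun_compose.scaleR_left blinfun_compose.scaleR_right
        blinfun_compose.diff_left blinfun_compose.diff_right)
  have nM: "n o\<^sub>L M = M o\<^sub>L n"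
    by (intro M_comm) (simp add: n_def T0_N blinfun_compose.scaleR_left blinfun_compose.scaleR_right
        blinfun_compose.diff_left blinfun_compose.diff_right)
  have commC: "blinfun_apply C (blinfun_apply M y) = blinfun_apply M (blinfun_apply C y)"
    "blinfun_apply C (blinfun_apply n y) = blinfun_apply n (blinfun_apply C y)"
    if "C = T \<or> C = T' \<or> (\<exists>q. C = lmul_op q)" for C y
  proof -
    have "C o\<^sub>L M = M o\<^sub>L C" "C o\<^sub>L n = n o\<^sub>L C"
      using that T0_T T0_T' N_T N_T' T0_lmul N_lmul by (auto intro: M_comm n_comm)
    then show "blinfun_apply C (blinfun_apply M y) = blinfun_apply M (blinfun_apply C y)"
      "blinfun_apply C (blinfun_apply n y) = blinfun_apply n (blinfun_apply C y)"
      by (metis blinfun_apply_blinfun_compose)+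
  qed
  note comm = commC [of T, OF disjI1 [OF refl]] commC [of T', OF disjI2 [OF disjI1 [OF refl]]]
    commC [of "lmul_op q" for q, OF disjI2 [OF disjI2 [OF exI [of "\<lambda>r. lmul_op q = lmul_op r" q for q, OF refl]]]]
  have nM_apply: "blinfun_apply n (blinfun_apply M y) = blinfun_apply M (blinfun_apply n y)" for y
    using nM by (metis blinfun_apply_blinfun_compose)
  \<comment> \<open>\<open>T\<close> and \<open>T'\<close> have sum \<open>M + a\<close> and product
    \<open>c - n\<close>. In the expansion of \<open>A o\<^sub>L A'\<close> the two terms in
    \<open>M\<^sup>2 n\<close> then cancel, which leaves \<open>D\<close>.\<close>
  have sum_apply: "blinfun_apply T y + blinfun_apply T' y = blinfun_apply M y + a *\<^sub>R y" for y
    using arg_cong [OF T_add_T', of "\<lambda>C. blinfun_apply C y"]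
    by (simp add: M_def blinfun.bilinear_simps)
  have TT'_apply: "blinfun_apply T (blinfun_apply T' y) = c *\<^sub>R y - blinfun_apply n y"
    "blinfun_apply T' (blinfun_apply T y) = c *\<^sub>R y - blinfun_apply n y" for y
    using arg_cong [OF T'_T, of "\<lambda>C. blinfun_apply C y"]
    by (simp_all add: n_def blinfun.bilinear_simps)
  have AA': "A o\<^sub>L A' = D"
  proof (rule blinfun_eqI)
    fix y :: "'a qmod"
    have "blinfun_apply (A o\<^sub>L A') y = blinfun_apply M (blinfun_apply M (blinfun_apply T (blinfun_apply T' y)))
        + blinfun_apply M (blinfun_apply n (blinfun_apply T y + blinfun_apply T' y))
        + blinfun_apply n (blinfun_apply n y)"
      by (simp add: A_def A'_def blinfun.bilinear_simps comm nM_apply)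
    then show "blinfun_apply (A o\<^sub>L A') y = blinfun_apply D y"
      unfolding sum_apply TT'_apply by (simp add: D_def blinfun.bilinear_simps nM_apply)
  qed
  have A'A: "A' o\<^sub>L A = D"
  proof (rule blinfun_eqI)
    fix y :: "'a qmod"
    have "blinfun_apply (A' o\<^sub>L A) y = blinfun_apply M (blinfun_apply M (blinfun_apply T' (blinfun_apply T y)))
        + blinfun_apply M (blinfun_apply n (blinfun_apply T y + blinfun_apply T' y))
        + blinfun_apply n (blinfun_apply n y)"
      by (simp add: A_def A'_def blinfun.bilinear_simps comm nM_apply)
    then show "blinfun_apply (A' o\<^sub>L A) y = blinfun_apply D y"
      unfolding sum_apply TT'_apply by (simp add: D_def blinfun.bilinear_simps nM_apply)
  qed
  have D_lmul: "D o\<^sub>L lmul_op q = lmul_op q o\<^sub>L D" for q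
    by (rule blinfun_eqI) (simp add: D_def blinfun.bilinear_simps comm)
  have sum: "A + A' = 2 *\<^sub>R ((M o\<^sub>L T0) + n)"
  proof -
    have "A + A' = (M o\<^sub>L (T + T')) + 2 *\<^sub>R n"
      by (simp add: A_def A'_def blinfun_compose.add_right scaleR_2)
    then show ?thesis
      by (simp add: T_add_T' blinfun_compose.scaleR_right scaleR_add_right)
  qed
  have sq: "lmul_op e1 o\<^sub>L lmul_op e1 = - id_blinfun" "lmul_op e2 o\<^sub>L lmul_op e2 = - id_blinfun"
    "lmul_op e3 o\<^sub>L lmul_op e3 = - id_blinfun"
    using lmul_op_of_real [of "- 1"] by (simp_all add: lmul_op_mult [symmetric] quat_units_square)
  \<comment> \<open>\<open>M\<close> and \<open>n\<close> commute with \<open>lmul_op q\<close>, and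
    \<open>q\<close> squares to \<open>- 1\<close>, so the sandwich turns \<open>n\<close> into
    \<open>- n\<close>. Subtracting three sandwiches from \<open>A'\<close> produces the
    \<open>4 n\<close> in \<open>re\<close>.\<close>
  have sandwich: "lmul_op q o\<^sub>L (A' o\<^sub>L lmul_op q) = (M o\<^sub>L (lmul_op q o\<^sub>L (T' o\<^sub>L lmul_op q))) - n"
    if "lmul_op q o\<^sub>L lmul_op q = - (id_blinfun :: 'a qop)" for q
  proof (rule blinfun_eqI)
    fix y :: "'a qmod"
    have "blinfun_apply (lmul_op q) (blinfun_apply (lmul_op q) y) = - y"
      using arg_cong [OF that, of "\<lambda>C. blinfun_apply C y"] by (simp add: blinfun.minus_left)
    then show "blinfun_apply (lmul_op q o\<^sub>L (A' o\<^sub>L lmul_op q)) y =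
        blinfun_apply ((M o\<^sub>L (lmul_op q o\<^sub>L (T' o\<^sub>L lmul_op q))) - n) y"
      by (simp add: A'_def blinfun.bilinear_simps comm)
  qed
  have four: "4 *\<^sub>R n = n + n + n + n"
    using scaleR_left_distrib [of 2 2 n] by (simp add: scaleR_2)
  have re: "A' - (lmul_op e1 o\<^sub>L (A' o\<^sub>L lmul_op e1)) - (lmul_op e2 o\<^sub>L (A' o\<^sub>L lmul_op e2))
      - (lmul_op e3 o\<^sub>L (A' o\<^sub>L lmul_op e3)) = 4 *\<^sub>R ((M o\<^sub>L T0) + n)"
    unfolding sandwich [OF sq(1)] sandwich [OF sq(2)] sandwich [OF sq(3)] scaleR_add_right four
      blinfun_compose.scaleR_right [symmetric] T'_re [symmetric]
    by (simp add: A'_def blinfun_compose.diff_right)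
  have "op_pow T 2 - (2 * qre s) *\<^sub>R T + (norm s)\<^sup>2 *\<^sub>R id_blinfun = A"
  proof (rule blinfun_eqI)
    fix y :: "'a qmod"
    have "blinfun_apply M (blinfun_apply T y) = blinfun_apply T (blinfun_apply T y)
        + blinfun_apply T' (blinfun_apply T y) - a *\<^sub>R blinfun_apply T y"
      using sum_apply [of "blinfun_apply T y"] by simp
    then show "blinfun_apply (op_pow T 2 - (2 * qre s) *\<^sub>R T + (norm s)\<^sup>2 *\<^sub>R id_blinfun) y = blinfun_apply A y"
      by (simp add: A_def TT'_apply blinfun.bilinear_simps numeral_2_eq_2 a_def c_def)
  qed
  then obtain B where "inverse_ops A B"
    using s by (auto simp: S_resolvent_set_def op_invertible_def is_op_inverse_def inverse_ops_def)
  then obtain D' where D': "inverse_ops D D'"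
    using modulus_invertible [OF _ AA' A'A sum re D_lmul D_lmul D_lmul] by blast
  \<comment> \<open>\<open>s\<close> and its conjugate, with sum \<open>a\<close> and product
    \<open>c\<close>, now replace \<open>T\<close> and \<open>T'\<close>; expanding their product
    gives the same \<open>D\<close>, this time without cancellation.\<close>
  have \<sigma>_sum: "?\<sigma> + ?\<sigma>' = a *\<^sub>R id_blinfun"
    using lmul_op_add [of s "quat_cnj s", where 'a = 'a] lmul_op_of_real [of a, where 'a = 'a] by (simp add: quat_cnj_def a_def)
  have \<sigma>_prod: "?\<sigma> o\<^sub>L ?\<sigma>' = c *\<^sub>R id_blinfun" "?\<sigma>' o\<^sub>L ?\<sigma> = c *\<^sub>R id_blinfun"
    using lmul_op_of_real [of c, where 'a = 'a]
    by (simp_all add: lmul_op_mult [symmetric] quat_cnj_mult c_def del: of_real_power)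
  have \<sigma>_apply: "blinfun_apply ?\<sigma> y + blinfun_apply ?\<sigma>' y = a *\<^sub>R y"
    "blinfun_apply ?\<sigma> (blinfun_apply ?\<sigma>' y) = c *\<^sub>R y" "blinfun_apply ?\<sigma>' (blinfun_apply ?\<sigma> y) = c *\<^sub>R y"
    for y :: "'a qmod"
    using arg_cong [OF \<sigma>_sum, of "\<lambda>C. blinfun_apply C y"] arg_cong [OF \<sigma>_prod(1), of "\<lambda>C. blinfun_apply C y"]
      arg_cong [OF \<sigma>_prod(2), of "\<lambda>C. blinfun_apply C y"]
    by (simp_all add: blinfun.bilinear_simps)
  define P where "P = (M o\<^sub>L ?\<sigma>) + n"
  define P' where "P' = (M o\<^sub>L ?\<sigma>') + n"
  have Q_P: "Q_c s T = - P"
  proof (rule blinfun_eqI)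
    fix y :: "'a qmod"
    have "blinfun_apply ?\<sigma> (blinfun_apply ?\<sigma> y) = a *\<^sub>R blinfun_apply ?\<sigma> y - c *\<^sub>R y"
      using \<sigma>_apply(1) [of "blinfun_apply ?\<sigma> y"] \<sigma>_apply(3) [of y] by (simp add: eq_diff_eq)
    moreover have "blinfun_apply ?\<sigma> (blinfun_apply T0 y) = blinfun_apply T0 (blinfun_apply ?\<sigma> y)"
      using arg_cong [OF T0_lmul [of s], of "\<lambda>C. blinfun_apply C y"] by simp
    ultimately show "blinfun_apply (Q_c s T) y = blinfun_apply (- P) y"
      by (simp add: Q_c_def op_lscale_def T_add_T' power2_eq_square lmul_op_mult P_def M_def n_def
          blinfun.bilinear_simps)
  qed
  have PP': "P o\<^sub>L P' = D" "P' o\<^sub>L P = D"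
  proof -
    show "P o\<^sub>L P' = D"
    proof (rule blinfun_eqI)
      fix y :: "'a qmod"
      have "blinfun_apply (P o\<^sub>L P') y = blinfun_apply M (blinfun_apply M (blinfun_apply ?\<sigma> (blinfun_apply ?\<sigma>' y)))
          + blinfun_apply M (blinfun_apply n (blinfun_apply ?\<sigma> y + blinfun_apply ?\<sigma>' y))
          + blinfun_apply n (blinfun_apply n y)"
        by (simp add: P_def P'_def blinfun.bilinear_simps comm nM_apply)
      then show "blinfun_apply (P o\<^sub>L P') y = blinfun_apply D y"
        unfolding \<sigma>_apply by (simp add: D_def blinfun.bilinear_simps)
    qed
    show "P' o\<^sub>L P = D"
    proof (rule blinfun_eqI)
      fix y :: "'a qmod"
      have "blinfun_apply (P' o\<^sub>L P) y = blinfun_apply M (blinfun_apply M (blinfun_apply ?\<sigma>' (blinfun_apply ?\<sigma> y)))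
          + blinfun_apply M (blinfun_apply n (blinfun_apply ?\<sigma> y + blinfun_apply ?\<sigma>' y))
          + blinfun_apply n (blinfun_apply n y)"
        by (simp add: P_def P'_def blinfun.bilinear_simps comm nM_apply)
      then show "blinfun_apply (P' o\<^sub>L P) y = blinfun_apply D y"
        unfolding \<sigma>_apply by (simp add: D_def blinfun.bilinear_simps)
    qed
  qed
  have DP: "D o\<^sub>L P = P o\<^sub>L D"
    using PP' by (metis blinfun_compose_assoc)
  \<comment> \<open>As \<open>D = P o\<^sub>L P'\<close>, the inverse of \<open>P\<close> is
    \<open>P' o\<^sub>L D'\<close>; for the left inverse \<open>D'\<close> has to be moved past
    \<open>P\<close>.\<close>
  have "inverse_ops (Q_c s T) (- (P' o\<^sub>L D'))"
    unfolding inverse_ops_def Q_P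
  proof
    show "(- P) o\<^sub>L (- (P' o\<^sub>L D')) = id_blinfun"
      using D' by (simp add: blinfun_compose.minus_left blinfun_compose.minus_right
          blinfun_compose_assoc [symmetric] PP' inverse_ops_def)
    have "P o\<^sub>L D' = D' o\<^sub>L P"
      by (rule inverse_ops_commute [OF D' DP [symmetric]])
    then have "(P' o\<^sub>L D') o\<^sub>L P = (P' o\<^sub>L P) o\<^sub>L D'"
      by (simp add: blinfun_compose_assoc)
    then show "(- (P' o\<^sub>L D')) o\<^sub>L (- P) = id_blinfun"
      using D' by (simp add: blinfun_compose.minus_left blinfun_compose.minus_right PP' inverse_ops_def)
  qed
  with that show ?thesis .
qed

end

section \<open>The integral representation\<close>

lemma imag_units_components:
  assumes "J \<in> imag_units"
  shows "qre J = 0" and "(qim1 J)\<^sup>2 + (qim2 J)\<^sup>2 + (qim3 J)\<^sup>2 = 1"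
proof -
  from assms have "J * J = - 1"
    by (simp add: imag_units_def power2_eq_square)
  then have eqs: "(qre J)\<^sup>2 - (qim1 J)\<^sup>2 - (qim2 J)\<^sup>2 - (qim3 J)\<^sup>2 = - 1"
    "qre J * qim1 J = 0" "qre J * qim2 J = 0" "qre J * qim3 J = 0"
    by (auto simp: quat_eq_iff power2_eq_square)
  show "qre J = 0"
  proof (rule ccontr)
    assume "qre J \<noteq> 0"
    with eqs have "(qre J)\<^sup>2 = - 1" by simp
    then show False
      using zero_le_power2 [of "qre J"] by linarith
  qed
  with eqs(1) show "(qim1 J)\<^sup>2 + (qim2 J)\<^sup>2 + (qim3 J)\<^sup>2 = 1"
    by simp
qed

lemma norm_slice_emb:
  assumes "J \<in> imag_units"
  shows "norm (slice_emb J z) = norm z"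
proof -
  have "(qre (slice_emb J z))\<^sup>2 + (qim1 (slice_emb J z))\<^sup>2 + (qim2 (slice_emb J z))\<^sup>2 + (qim3 (slice_emb J z))\<^sup>2
      = (Re z)\<^sup>2 + ((qim1 J)\<^sup>2 + (qim2 J)\<^sup>2 + (qim3 J)\<^sup>2) * (Im z)\<^sup>2"
    by (simp add: slice_emb_def imag_units_components (1) [OF assms] power_mult_distrib algebra_simps)
  also have "\<dots> = (Re z)\<^sup>2 + (Im z)\<^sup>2"
    by (simp add: imag_units_components (2) [OF assms])
  finally show ?thesis
    by (simp add: norm_quat_def cmod_def)
qed

lemma slice_emb_eq: "slice_emb J z = Re z *\<^sub>R 1 + Im z *\<^sub>R J"
  by (simp add: slice_emb_def quat_eq_iff)

lemma continuous_slice_emb: "continuous_on A (slice_emb J)"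
  unfolding slice_emb_eq [abs_def] by (intro continuous_intros)

lemma slice_emb_power:
  assumes "J \<in> imag_units"
  shows "slice_emb J (z * w) = slice_emb J z * slice_emb J w"
    and "slice_emb J (z ^ k) = slice_emb J z ^ k"
proof -
  have J: "J * J = - 1"
    using assms by (simp add: imag_units_def power2_eq_square)
  show mult: "slice_emb J (z * w) = slice_emb J z * slice_emb J w" for z w
    by (simp add: slice_emb_eq algebra_simps J)
  show "slice_emb J (z ^ k) = slice_emb J z ^ k"
    by (induction k) (simp_all add: mult, simp add: slice_emb_eq)
qed

context BC_operator
begin

text \<open>With \<open>E\<close> the shift of \<open>k\<close>, the recurrence factors as
  \<open>(E - T) (E - T')\<close>, since \<open>T + T' = 2 T\<^sub>0\<close> and
  \<open>T T' = N\<close>. This leaves a one-term recurrence for the difference, and unrolling the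
  first claim gives the second.\<close>

lemma moments_solution:
  assumes M: "M 0 = 0" "M 1 = id_blinfun"
    "\<And>k. M (Suc (Suc k)) = 2 *\<^sub>R (T0 o\<^sub>L M (Suc k)) - (N o\<^sub>L M k)"
  shows "M (Suc k) - (T' o\<^sub>L M k) = op_pow T k"
    and "M (Suc k) = (\<Sum>j=0..k. op_pow T (k - j) o\<^sub>L op_pow T' j)"
proof -
  show *: "M (Suc k) - (T' o\<^sub>L M k) = op_pow T k" for k
  proof (induction k)
    case 0
    then show ?case by (simp add: M(1) M(2) [simplified] blinfun_compose.zero_right)
  next
    case (Suc k)
    have "M (Suc (Suc k)) = ((T + T') o\<^sub>L M (Suc k)) - (T o\<^sub>L (T' o\<^sub>L M k))"
      by (simp add: M(3) T_add_T' blinfun_compose.scaleR_left blinfun_compose_assoc)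
    then have "M (Suc (Suc k)) - (T' o\<^sub>L M (Suc k)) = T o\<^sub>L (M (Suc k) - (T' o\<^sub>L M k))"
      by (simp add: blinfun_compose.add_left blinfun_compose.diff_right)
    then show ?case by (simp add: Suc)
  qed
  have comm: "T' o\<^sub>L op_pow T k = op_pow T k o\<^sub>L T'" for k
    by (induction k) (use T'_T in \<open>simp_all add: compose_commute\<close>)
  show "M (Suc k) = (\<Sum>j=0..k. op_pow T (k - j) o\<^sub>L op_pow T' j)"
  proof (induction k)
    case 0
    then show ?case using M(2) by simp
  next
    case (Suc k)
    have "(\<Sum>j=0..Suc k. op_pow T (Suc k - j) o\<^sub>L op_pow T' j) =
        op_pow T (Suc k) + (\<Sum>j=0..k. op_pow T (k - j) o\<^sub>L (T' o\<^sub>L op_pow T' j))"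
      unfolding sum.atLeast0_atMost_Suc_shift by simp
    also have "\<dots> = op_pow T (Suc k) + (T' o\<^sub>L M (Suc k))"
      by (simp add: Suc blinfun_compose.sum_right blinfun_compose_assoc [symmetric] comm)
    also have "\<dots> = M (Suc (Suc k))"
      using * [of "Suc k"] by (simp add: algebra_simps)
    finally show ?case by simp
  qed
qed

lemma P2_integral:
  assumes U: "slice_cauchy_domain U" "bounded U" "S_spectrum T \<subseteq> U"
    and J: "J \<in> imag_units" and \<Gamma>: "positive_boundary (slice_trace U J) \<Gamma>"
  shows "P2 m T = (1 / (2 * pi)) *\<^sub>R slice_integral J \<Gamma> (\<lambda>s. P2_L s T) (\<lambda>s. s ^ (m + 1))"
proof -
  let ?I = "lmul_op J :: 'a qop"
  have I_I: "?I o\<^sub>L ?I = - id_blinfun"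
    using lmul_op_of_real [of "- 1", where 'a = 'a] J
    by (simp add: lmul_op_mult [symmetric] imag_units_def power2_eq_square)
  interpret pencil: quadratic_pencil ?I T0 N
    by unfold_locales (simp_all add: I_I T0_lmul N_lmul T0_N)
  have emb: "pencil.emb z = lmul_op (slice_emb J z)" for z
    by (rule blinfun_eqI) (simp add: pencil.emb_def slice_emb_eq lmul_op_add lmul_op.rep_eq
        blinfun.bilinear_simps lmult_distrib lmult_scaleR lmult_of_real [of 1, simplified])
  have Q: "pencil.Q z = Q_c (slice_emb J z) T" for z
    by (simp add: pencil.Q_def Q_c_def emb op_lscale_def T_add_T' power2_eq_square lmul_op_mult
        blinfun_compose.scaleR_right)
  let ?D = "slice_trace U J"
  have jb: "jordan_boundary ?D \<Gamma>"
    using \<Gamma> by (simp add: positive_boundary_def)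
  have "open ?D"
    using U(1) open_vimage [OF _ continuous_slice_emb]
    by (auto simp: slice_cauchy_domain_def slice_trace_def vimage_def)
  interpret pencil_cycle ?I T0 N \<Gamma> ?D
  proof
    show "finite \<Gamma>"
      using jb by (simp add: jordan_boundary_def)
    show "valid_path \<gamma>" "pathfinish \<gamma> = pathstart \<gamma>" if "\<gamma> \<in> \<Gamma>" for \<gamma>
      using jb that by (auto simp: jordan_boundary_def)
    show "open ?D" by fact
    show "bounded ?D"
      using U(2) norm_slice_emb [OF J] unfolding bounded_iff slice_trace_def
      by (metis mem_Collect_eq)
    show "- ?D \<subseteq> pencil.resolvent_set"
    proof
      fix z assume "z \<in> - ?D"
      then have "slice_emb J z \<in> S_resolvent_set T"
        using U(3) by (auto simp: slice_trace_def S_spectrum_def)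
      then show "z \<in> pencil.resolvent_set"
        using Q_c_invertible by (auto simp: pencil.resolvent_set_def Q)
    qed
    show "path_image \<gamma> \<inter> ?D = {}" if "\<gamma> \<in> \<Gamma>" for \<gamma>
    proof -
      have "path_image \<gamma> \<subseteq> frontier ?D"
        using jb that by (auto simp: jordan_boundary_def)
      then show ?thesis
        using frontier_disjoint_eq [of ?D] \<open>open ?D\<close> by blast
    qed
    show "(\<Sum>\<gamma>\<in>\<Gamma>. winding_number \<gamma> z) = 1" if "z \<in> ?D" for z
      using \<Gamma> that by (simp add: positive_boundary_def)
  qed
  \<comment> \<open>\<open>op_inv\<close> selects an inverse in \<open>BX\<close>, so right
    linearity of \<open>pencil.R z\<close> has to be supplied here.\<close>
  have op_inv: "op_inv (Q_c (slice_emb J z) T) = pencil.R z" if z: "z \<in> pencil.resolvent_set" for z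
  proof (rule op_inv_eqI)
    have "inverse_ops (Q_c (slice_emb J z) T) (pencil.R z)"
      using pencil.inverse_R [OF z] by (simp add: Q)
    then show "is_op_inverse (Q_c (slice_emb J z) T) (pencil.R z)"
      using inverse_ops_BX [OF Q_c_BX] by (auto simp: is_op_inverse_def inverse_ops_def)
  qed
  \<comment> \<open>These belong to the two terms of the factor \<open>s - T'\<close>:
    multiplication by \<open>s\<close> raises the index of \<open>X\<close> by one, while
    \<open>T'\<close> remains outside. The right factor \<open>- ?I\<close> comes from
    \<open>ds\<^sub>J\<close>.\<close>
  let ?F = "\<lambda>z. X (Suc (Suc m)) z o\<^sub>L (- ?I)" and ?F' = "\<lambda>z. X (Suc m) z o\<^sub>L (- ?I)"
  have integrand: "P2_L (slice_emb J z) T \<cdot>\<^sub>r (slice_emb J h * (- J)) \<cdot>\<^sub>r slice_emb J z ^ (m + 1) =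
      4 *\<^sub>R (pencil.act h (?F z) - (T' o\<^sub>L pencil.act h (?F' z)))"
    if z: "z \<in> pencil.resolvent_set" for z h
  proof -
    let ?R = "pencil.R z" and ?e = "pencil.emb z" and ?p = "pencil.emb (z ^ (m + 1))" and ?h = "pencil.emb h"
    let ?Y = "(?e - T0) o\<^sub>L (?R o\<^sub>L ?R)"
    have cR: "pencil.central ?R" and ce: "pencil.central (pencil.emb w)" for w
      by (rule pencil.central_R [OF z], rule pencil.central_emb)
    have cY: "pencil.central ?Y"
      by (intro pencil.central_compose pencil.central_diff cR ce pencil.central_S)
    have RRe: "?R o\<^sub>L (?R o\<^sub>L ?e) = ?e o\<^sub>L (?R o\<^sub>L ?R)"
      by (simp add: pencil.central_emb_commute cR pencil.central_compose blinfun_compose_assoc [symmetric])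
    have "P2_L (slice_emb J z) T = 4 *\<^sub>R ((?e - T') o\<^sub>L ?Y)"
    proof -
      have "T0 o\<^sub>L (?e - T') = (?e - T') o\<^sub>L T0"
        using ce [of z] T0_T' by (simp add: pencil.central_def blinfun_compose.diff_left blinfun_compose.diff_right)
      then have T0: "T0 o\<^sub>L ((?e - T') o\<^sub>L A) = (?e - T') o\<^sub>L (T0 o\<^sub>L A)" for A
        by (simp add: blinfun_compose_assoc [symmetric])
      have "P2_L (slice_emb J z) T = 4 *\<^sub>R (((?e - T') o\<^sub>L (?R o\<^sub>L ?R)) o\<^sub>L ?e)
          - 4 *\<^sub>R (T0 o\<^sub>L ((?e - T') o\<^sub>L (?R o\<^sub>L ?R)))"
        by (simp add: P2_L_def F_L_def op_rscale_def op_inv [OF z] emb numeral_2_eq_2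
            blinfun_compose.scaleR_left blinfun_compose.scaleR_right blinfun_compose.minus_left
            blinfun_compose.minus_right)
      also have "\<dots> = 4 *\<^sub>R ((?e - T') o\<^sub>L ((?e o\<^sub>L (?R o\<^sub>L ?R)) - (T0 o\<^sub>L (?R o\<^sub>L ?R))))"
        by (simp add: T0 RRe blinfun_compose_assoc scaleR_diff_right [symmetric]
            blinfun_compose.diff_right [symmetric])
      finally show ?thesis
        by (simp add: blinfun_compose.diff_left)
    qed
    moreover have "lmul_op (slice_emb J h * (- J)) = - (?h o\<^sub>L ?I)"
      by (simp add: lmul_op_mult lmul_op_minus emb blinfun_compose.minus_right)
    moreover have "lmul_op (slice_emb J z ^ (m + 1)) = ?p"
      by (simp only: emb slice_emb_power (2) [OF J])
    \<comment> \<open>Moves the path derivative to the front, so that the integrand takes the shape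
      of \<open>pencil.act\<close>.\<close>
    moreover have "?Y o\<^sub>L ((?h o\<^sub>L ?I) o\<^sub>L ?p) = ?h o\<^sub>L ((?p o\<^sub>L ?Y) o\<^sub>L ?I)"
    proof -
      have "?I o\<^sub>L ?p = ?p o\<^sub>L ?I"
        by (intro pencil.central_emb_commute pencil.central_I)
      moreover have "?Y o\<^sub>L (?h o\<^sub>L ?p) = (?h o\<^sub>L ?p) o\<^sub>L ?Y"
        by (simp only: pencil.emb_mult [symmetric] pencil.central_emb_commute [OF cY])
      ultimately show ?thesis
        by (simp add: blinfun_compose_assoc) (simp add: blinfun_compose_assoc [symmetric])
    qed
    ultimately have "P2_L (slice_emb J z) T \<cdot>\<^sub>r (slice_emb J h * (- J)) \<cdot>\<^sub>r slice_emb J z ^ (m + 1) =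
        - (4 *\<^sub>R ((?e - T') o\<^sub>L (?h o\<^sub>L ((?p o\<^sub>L ?Y) o\<^sub>L ?I))))"
      by (simp add: op_rscale_def blinfun_compose.scaleR_left blinfun_compose.minus_left
          blinfun_compose.minus_right blinfun_compose_assoc)
    moreover have "?F' z = - ((?p o\<^sub>L ?Y) o\<^sub>L ?I)"
      by (simp add: X_def blinfun_compose.minus_right)
    moreover have "pencil.act h (?F z) = ?e o\<^sub>L pencil.act h (?F' z)"
    proof -
      have "pencil.act h (?F z) = pencil.emb (h * z ^ Suc (Suc m)) o\<^sub>L (?Y o\<^sub>L (- ?I))"
        by (simp only: X_def pencil.act_eq pencil.emb_mult blinfun_compose_assoc)
      also have "h * z ^ Suc (Suc m) = z * (h * z ^ Suc m)"
        by simp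
      also have "pencil.emb \<dots> o\<^sub>L (?Y o\<^sub>L (- ?I)) = ?e o\<^sub>L pencil.act h (?F' z)"
        by (simp only: X_def pencil.act_eq pencil.emb_mult blinfun_compose_assoc)
      finally show ?thesis .
    qed
    ultimately show ?thesis
      by (simp add: pencil.act_eq blinfun_compose.diff_left blinfun_compose.minus_right scaleR_diff_right)
  qed
  have L: "bounded_linear (\<lambda>A. A o\<^sub>L (- ?I))"
    "(?I o\<^sub>L A) o\<^sub>L (- ?I) = ?I o\<^sub>L (A o\<^sub>L (- ?I))" for A :: "'a qop"
    by (rule blinfun_compose.bounded_linear_left, rule blinfun_compose_assoc)
  have F: "cintegrable ?F" "cint ?F = (real (m + 2) / 2) *\<^sub>R (V (Suc m) o\<^sub>L (- ?I))"
    and F': "cintegrable ?F'" "cint ?F' = (real (m + 1) / 2) *\<^sub>R (V m o\<^sub>L (- ?I))"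
    using cint_linear [OF L cint_X(1)] cint_X(2)
    by (simp_all add: blinfun_compose.scaleR_left)
  have "slice_integral J \<Gamma> (\<lambda>s. P2_L s T) (\<lambda>s. s ^ (m + 1)) = 4 *\<^sub>R (cint ?F - (T' o\<^sub>L cint ?F'))"
  proof -
    have "integral {0..1} (\<lambda>t. P2_L (slice_emb J (\<gamma> t)) T
               \<cdot>\<^sub>r (slice_emb J (vector_derivative \<gamma> (at t within {0..1})) * (- J))
               \<cdot>\<^sub>r slice_emb J (\<gamma> t) ^ (m + 1)) = 4 *\<^sub>R (pencil.vint \<gamma> ?F - (T' o\<^sub>L pencil.vint \<gamma> ?F'))"
      if \<gamma>: "\<gamma> \<in> \<Gamma>" for \<gamma>
    proof -
      let ?d = "\<lambda>t. vector_derivative \<gamma> (at t within {0..1})"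
      have int: "((\<lambda>t. pencil.act (?d t) (?F (\<gamma> t))) has_integral pencil.vint \<gamma> ?F) {0..1}"
        "((\<lambda>t. pencil.act (?d t) (?F' (\<gamma> t))) has_integral pencil.vint \<gamma> ?F') {0..1}"
        using F(1) F'(1) \<gamma>
        by (auto simp: cintegrable_def pencil.vintegrable_def pencil.vint_def intro!: integrable_integral)
      \<comment> \<open>\<open>T'\<close> need not commute with \<open>?I\<close>, so
        \<open>cint_linear\<close> does not apply and only real linearity of the integral is
        used.\<close>
      have "((\<lambda>t. T' o\<^sub>L pencil.act (?d t) (?F' (\<gamma> t))) has_integral (T' o\<^sub>L pencil.vint \<gamma> ?F')) {0..1}"
        using has_integral_linear [OF int(2) blinfun_compose.bounded_linear_right [of T']] by (simp add: o_def)
      then have "((\<lambda>t. 4 *\<^sub>R (pencil.act (?d t) (?F (\<gamma> t)) - (T' o\<^sub>L pencil.act (?d t) (?F' (\<gamma> t)))))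
          has_integral 4 *\<^sub>R (pencil.vint \<gamma> ?F - (T' o\<^sub>L pencil.vint \<gamma> ?F'))) {0..1}"
        by (intro has_integral_cmul has_integral_diff int(1))
      moreover have "\<gamma> t \<in> pencil.resolvent_set" if "t \<in> {0..1}" for t
        using path_image_subset [OF \<gamma>] that by (auto simp: path_image_def)
      ultimately show ?thesis
        by (intro integral_unique) (rule has_integral_eq, simp_all only: integrand)
    qed
    then show ?thesis
      by (simp add: slice_integral_def cint_def scaleR_sum_right [symmetric] sum_subtractf
          blinfun_compose.sum_right)
  qed
  \<comment> \<open>The normalisation turns \<open>V 1 = (2 * pi) *\<^sub>R ?I\<close> into the
    identity.\<close>
  moreover define M where "M k = (1 / (2 * pi)) *\<^sub>R (V k o\<^sub>L (- ?I))" for k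
  have V_M: "V k o\<^sub>L (- ?I) = (2 * pi) *\<^sub>R M k" for k
    by (simp add: M_def)
  ultimately have int: "(1 / (2 * pi)) *\<^sub>R slice_integral J \<Gamma> (\<lambda>s. P2_L s T) (\<lambda>s. s ^ (m + 1)) =
      (2 * real (m + 2)) *\<^sub>R M (Suc m) - (2 * real (m + 1)) *\<^sub>R (T' o\<^sub>L M m)"
    by (simp add: F(2) F'(2) V_M scaleR_diff_right blinfun_compose.scaleR_right
        add_divide_distrib)
  have M: "M 0 = 0" "M 1 = id_blinfun"
    by (simp_all add: M_def V_0 V_1 [simplified] I_I blinfun_compose.zero_left
        blinfun_compose.scaleR_left blinfun_compose.minus_right)
  have "M (Suc (Suc k)) = 2 *\<^sub>R (T0 o\<^sub>L M (Suc k)) - (N o\<^sub>L M k)" for k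
    by (simp add: M_def V_recurrence blinfun_compose.diff_left blinfun_compose.scaleR_left
        blinfun_compose.scaleR_right blinfun_compose_assoc scaleR_diff_right)
  note moments = moments_solution [OF M this, of m]
  have "P2 m T = 2 *\<^sub>R (real (m + 1) *\<^sub>R (M (Suc m) - (T' o\<^sub>L M m)) + M (Suc m))"
    by (simp only: P2_def moments(1) moments(2) [symmetric])
  also have "\<dots> = (2 * real (m + 2)) *\<^sub>R M (Suc m) - (2 * real (m + 1)) *\<^sub>R (T' o\<^sub>L M m)"
  proof -
    have "2 *\<^sub>R (c *\<^sub>R (a - b) + a) = (2 * (c + 1)) *\<^sub>R a - (2 * c) *\<^sub>R b" for c and a b :: "'a qop"
      by (simp add: algebra_simps)
    from this [of "real (m + 1)"] show ?thesis
      by (simp add: add.commute)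
  qed
  finally show ?thesis
    using int by simp
qed

end

theorem theorem3p19:
  fixes T :: "'a::banach qop"
    and m :: nat
    and U :: "quat set"
    and J :: quat
    and \<Gamma> :: "(real \<Rightarrow> complex) set"
  assumes "T \<in> BC"
    and "slice_cauchy_domain U"
    and "bounded U"
    and "S_spectrum T \<subseteq> U"
    and "J \<in> imag_units"
    and "positive_boundary (slice_trace U J) \<Gamma>"
  shows "P2 m T = (1 / (2 * pi)) *\<^sub>R slice_integral J \<Gamma> (\<lambda>s. P2_L s T) (\<lambda>s. s ^ (m + 1))"
proof -
  obtain A0 A1 A2 A3 where "BC_operator T A0 A1 A2 A3"
    using assms(1) by (auto simp: BC_def BC_operator_def)
  then show ?thesis
    using assms(2-) by (rule BC_operator.P2_integral)
qed

end
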